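(* Let $b,\iota>0$, let $k\ge 0$ be an integer, and let $\sigma\in\mathbb R$ with $\sigma>\iota+b$. Then the functions $\{Q^{(k)}_{n,1}\}_{n=0}^\infty$ and $\{Q^{(k)}_{n,-1}\}_{n=0}^\infty$ form orthogonal bases of $L^2(\mathbb R,d\mu)_{1}$ and $L^2(\mathbb R,d\mu)_{-1}$, respectively. Their norms in $L^2(\mathbb R,d\mu)$ are given by $$\|Q^{(k)}_{n,1}\|^2=2^{2(\iota+b)}\,\frac{\Gamma(n+\sigma-\iota-b)\,\Gamma\!\left(n+2k+\frac{\iota+2b+1}{2}\right)}{n!\,\left(2n+2k+\sigma-\frac{\iota+1}{2}\right)\Gamma\!\left(n+2k+\sigma-\frac{\iota+1}{2}\right)}$$ and $$\|Q^{(k)}_{n,-1}\|^2=2^{2(\iota+b)}\,\frac{\Gamma(n+\sigma-\iota-b)\,\Gamma\!\left(n+2k+\frac{\iota+2b+1}{2}+1\right)}{n!\,\left(2n+2k+\sigma-\frac{\iota-1}{2}\right)\Gamma\!\left(n+2k+\sigma-\frac{\iota-1}{2}\right)} .$$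
   Context: The measure on $\mathbb R$ is $d\mu(t)=2^{2b+\iota}|\sinh t|^{2b}\,|\sinh(2t)|^{\iota}\,dt$. $L^2(\mathbb R,d\mu)_{1}$ and $L^2(\mathbb R,d\mu)_{-1}$ denote the closed subspaces of $L^2(\mathbb R,d\mu)$ consisting of even and of odd functions, respectively. Put $w_{\sigma,k}(t)=(\cosh t)^{-\sigma}(\tanh t)^{2k}$, and $$\sigma_0=\sigma-(\iota+b+1),\qquad \delta_0=\frac{\iota-1}{2}+b,\qquad \delta_1=\delta_0+1 .$$ $P_n^{\alpha,\beta}$ denotes the Jacobi polynomial in the standard normalization $P_n^{\alpha,\beta}(1)=\frac{(\alpha+1)_n}{n!}$, orthogonal on $(-1,1)$ with respect to $(1-x)^\alpha(1+x)^\beta dx$; here $(a)_n=a(a+1)\cdots(a+n-1)$. For $n=0,1,2,\dots$, $$Q^{(k)}_{n,1}(t)=w_{\sigma,k}(t)\,P_n^{\sigma_0,\,\delta_0+2k}(2\tanh^2t-1),\qquad Q^{(k)}_{n,-1}(t)=w_{\sigma,k}(t)\,P_n^{\sigma_0,\,\delta_1+2k}(2\tanh^2t-1)\,\tanh t .$$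
   Formalization: In the even norm formula, when n = k = 0 and σ = (ι+1)/2 (possible if 2b+ι < 1), the printed factor (2n+2k+σ−(ι+1)/2)Γ(n+2k+σ−(ι+1)/2) is the undefined 0·Γ(0); it is replaced there by its limit 1. *)

theory Defs
  imports "HOL-Analysis.Analysis" "HOL-Computational_Algebra.Computational_Algebra"
begin

section \<open>Jacobi polynomials\<close>

definition is_jacobi_poly :: "real \<Rightarrow> real \<Rightarrow> nat \<Rightarrow> real poly \<Rightarrow> bool" where
  "is_jacobi_poly \<alpha> \<beta> n p \<longleftrightarrow>
     degree p = n \<and>
     poly p 1 = pochhammer (\<alpha> + 1) n / fact n \<and>
     (\<forall>q. degree q < n \<longrightarrow>
        (LBINT x:{-1<..<1}. (1 - x) powr \<alpha> * (1 + x) powr \<beta> * (poly p x * poly q x)) = 0)"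

text \<open>The description is proper for \<open>\<alpha>, \<beta> > -1\<close>; see \<open>jacobi_poly_unique_existence\<close> below.\<close>

definition jacobi_poly :: "real \<Rightarrow> real \<Rightarrow> nat \<Rightarrow> real poly" where
  "jacobi_poly \<alpha> \<beta> n = (THE p. is_jacobi_poly \<alpha> \<beta> n p)"

text \<open>The hypergeometric representation
  \<open>(\<alpha>+1)\<^sub>n / n! \<cdot> \<^sub>2F\<^sub>1(-n, n+\<alpha>+\<beta>+1; \<alpha>+1; (1-x)/2)\<close>, used as the existence witness.\<close>

definition jacobi_coeff :: "real \<Rightarrow> real \<Rightarrow> nat \<Rightarrow> nat \<Rightarrow> real" where
  "jacobi_coeff \<alpha> \<beta> n m =
     pochhammer (\<alpha> + 1) n / fact n *
     (pochhammer (- real n) m * pochhammer (real n + \<alpha> + \<beta> + 1) m /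
        (pochhammer (\<alpha> + 1) m * fact m))"

definition jacobi_hyp :: "real \<Rightarrow> real \<Rightarrow> nat \<Rightarrow> real poly" where
  "jacobi_hyp \<alpha> \<beta> n = (\<Sum>m\<le>n. smult (jacobi_coeff \<alpha> \<beta> n m) ([:1/2, -1/2:] ^ m))"

lemma poly_jacobi_hyp:
  "poly (jacobi_hyp \<alpha> \<beta> n) x = (\<Sum>m\<le>n. jacobi_coeff \<alpha> \<beta> n m * ((1 - x) / 2) ^ m)"
  by (simp add: jacobi_hyp_def poly_sum poly_power diff_divide_distrib)

lemma poly_jacobi_hyp_1: "poly (jacobi_hyp \<alpha> \<beta> n) 1 = pochhammer (\<alpha> + 1) n / fact n"
proof -
  have "poly (jacobi_hyp \<alpha> \<beta> n) 1 = (\<Sum>m\<le>n. if m = 0 then jacobi_coeff \<alpha> \<beta> n 0 else 0)"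
    unfolding poly_jacobi_hyp by (intro sum.cong) auto
  also have "\<dots> = jacobi_coeff \<alpha> \<beta> n 0" by simp
  finally show ?thesis by (simp add: jacobi_coeff_def)
qed

lemma degree_jacobi_hyp:
  assumes "\<alpha> > -1" "\<beta> > -1"
  shows "degree (jacobi_hyp \<alpha> \<beta> n) = n"
proof (rule antisym)
  have deg_pow: "degree ([:1/2, -1/2:] ^ m :: real poly) = m" for m
    by (simp add: degree_power_eq)
  show le: "degree (jacobi_hyp \<alpha> \<beta> n) \<le> n"
    unfolding jacobi_hyp_def
    by (intro degree_sum_le) (auto intro!: order.trans[OF degree_smult_le] simp: deg_pow[simplified])
  have "coeff (jacobi_hyp \<alpha> \<beta> n) n =
      (\<Sum>m\<le>n. jacobi_coeff \<alpha> \<beta> n m * coeff ([:1/2, -1/2:] ^ m) n)"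
    by (simp add: jacobi_hyp_def coeff_sum)
  also have "\<dots> = (\<Sum>m\<le>n. if m = n then jacobi_coeff \<alpha> \<beta> n n * coeff ([:1/2, -1/2:] ^ n) n else 0)"
    by (intro sum.cong) (auto simp: coeff_eq_0 deg_pow[simplified])
  also have "\<dots> = jacobi_coeff \<alpha> \<beta> n n * lead_coeff ([:1/2, -1/2:] ^ n)"
    by (simp only: deg_pow) simp
  finally have c: "coeff (jacobi_hyp \<alpha> \<beta> n) n = \<dots>" .
  have "pochhammer (real n + \<alpha> + \<beta> + 1) n \<noteq> 0"
  proof (cases "n = 0")
    case False
    hence "real n \<ge> 1" by simp
    hence "real n + \<alpha> + \<beta> + 1 > 0" using assms by linarith
    thus ?thesis using pochhammer_pos[of "real n + \<alpha> + \<beta> + 1" n] by linarith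
  qed auto
  moreover have "pochhammer (\<alpha> + 1) n > 0" using assms by (intro pochhammer_pos) auto
  moreover have "pochhammer (- real n) n \<noteq> 0" by (auto simp: pochhammer_eq_0_iff)
  ultimately have "jacobi_coeff \<alpha> \<beta> n n \<noteq> 0" by (simp add: jacobi_coeff_def)
  moreover have "lead_coeff ([:1/2, -1/2:] ^ n :: real poly) \<noteq> 0"
    by (simp add: lead_coeff_power)
  ultimately have "coeff (jacobi_hyp \<alpha> \<beta> n) n \<noteq> 0" using c by simp
  thus "n \<le> degree (jacobi_hyp \<alpha> \<beta> n)" by (rule le_degree)
qed

lemma jacobi_weight_moment:
  fixes a b :: real
  assumes "a > -1" "b > -1"
  shows "has_bochner_integral lborel
     (\<lambda>x. indicator {-1<..<1} x *\<^sub>R ((1 - x) powr a * (1 + x) powr b))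
     (2 powr (a + b + 1) * Beta (a + 1) (b + 1))"
proof -
  define g where "g = (\<lambda>u::real. indicator {0<..<1} u *\<^sub>R (u powr b * (1 - u) powr a))"
  have h: "((\<lambda>u. u powr b * (1 - u) powr a) has_integral Beta (b + 1) (a + 1)) {0<..<1}"
    using has_integral_Beta_real[of "b + 1" "a + 1"] assms by (simp add: has_integral_Icc_iff_Ioo)
  have nn: "(\<lambda>u. u powr b * (1 - u) powr a) absolutely_integrable_on {0<..<1}"
    using h by (intro nonnegative_absolutely_integrable_1) (auto simp: has_integral_iff)
  have "set_integrable lborel {0<..<1} (\<lambda>u. u powr b * (1 - u) powr a)"
    using nn unfolding set_integrable_def
    by (subst (asm) integrable_completion) auto
  from this set_borel_integral_eq_integral(2)[OF this] h
  have "has_bochner_integral lborel g (Beta (b + 1) (a + 1))"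
    by (auto simp: has_bochner_integral_iff g_def set_integrable_def set_lebesgue_integral_def
        has_integral_iff)
  hence "has_bochner_integral lborel (\<lambda>x. g (1/2 + (1/2) * x)) (Beta (b + 1) (a + 1) /\<^sub>R \<bar>1/2\<bar>)"
    by (subst (asm) lborel_has_bochner_integral_real_affine_iff[of "1/2" _ _ "1/2"]) auto
  hence "has_bochner_integral lborel (\<lambda>x. 2 powr (a + b) * g (1/2 + (1/2) * x))
           (2 powr (a + b) * (Beta (b + 1) (a + 1) /\<^sub>R \<bar>1/2\<bar>))"
    by (rule has_bochner_integral_mult_right)
  also have "(\<lambda>x. 2 powr (a + b) * g (1/2 + (1/2) * x)) =
      (\<lambda>x. indicator {-1<..<1} x *\<^sub>R ((1 - x) powr a * (1 + x) powr b))"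
  proof
    fix x :: real
    show "2 powr (a + b) * g (1/2 + (1/2) * x) =
        indicator {-1<..<1} x *\<^sub>R ((1 - x) powr a * (1 + x) powr b)"
    proof (cases "x \<in> {-1<..<1}")
      case True
      have e: "1/2 + (1/2) * x = (1 + x) / 2" "1 - (1/2 + (1/2) * x) = (1 - x) / 2"
        by (simp_all add: field_simps)
      thus ?thesis using True
        unfolding g_def e(2) unfolding e(1) by (simp add: powr_divide powr_add)
    next
      case False
      hence "1/2 + (1/2) * x \<notin> {0<..<1}" by auto
      thus ?thesis using False by (simp add: g_def)
    qed
  qed
  also have "2 powr (a + b) * (Beta (b + 1) (a + 1) /\<^sub>R \<bar>1/2\<bar>) =
      2 powr (a + b + 1) * Beta (a + 1) (b + 1)"
    by (simp add: powr_add Beta_commute)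
  finally show ?thesis .
qed

lemma jacobi_weight_integrable:
  fixes \<alpha> \<beta> :: real
  assumes "\<alpha> > -1" "\<beta> > -1"
  shows "integrable lborel
     (\<lambda>x. indicator {-1<..<1} x *\<^sub>R ((1 - x) powr \<alpha> * (1 + x) powr \<beta> * poly p x))"
proof -
  have "\<exists>B. \<forall>x\<in>{-1..1}. norm (poly p x) \<le> B"
  proof -
    have "compact (poly p ` {-1..1})" by (intro compact_continuous_image continuous_intros) auto
    hence "bounded (poly p ` {-1..1})" by (rule compact_imp_bounded)
    thus ?thesis by (auto simp: bounded_iff)
  qed
  then obtain B where B: "\<And>x. x \<in> {-1..1} \<Longrightarrow> norm (poly p x) \<le> B" by blast
  have "B \<ge> 0" using B[of 0] norm_ge_zero[of "poly p 0"] by (auto intro: order.trans)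
  show ?thesis
  proof (rule Bochner_Integration.integrable_bound)
    show "integrable lborel
       (\<lambda>x. B * (indicator {-1<..<1} x *\<^sub>R ((1 - x) powr \<alpha> * (1 + x) powr \<beta>)))"
      using jacobi_weight_moment[OF assms]
      by (intro integrable_mult_right) (auto simp: has_bochner_integral_iff)
    have [measurable]: "poly p \<in> borel_measurable borel"
      by (intro borel_measurable_continuous_onI continuous_intros)
    show "(\<lambda>x. indicator {-1<..<1} x *\<^sub>R ((1 - x) powr \<alpha> * (1 + x) powr \<beta> * poly p x))
        \<in> borel_measurable lborel"
      by measurable
    have "\<bar>poly p x\<bar> * ((1 - x) powr \<alpha> * (1 + x) powr \<beta>) \<le> B * ((1 - x) powr \<alpha> * (1 + x) powr \<beta>)"
      if "x \<in> {-1<..<1}" for x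
      using that B[of x] by (intro mult_right_mono) auto
    thus "AE x in lborel. norm (indicator {-1<..<1} x *\<^sub>R ((1 - x) powr \<alpha> * (1 + x) powr \<beta> * poly p x))
        \<le> norm (B * (indicator {-1<..<1} x *\<^sub>R ((1 - x) powr \<alpha> * (1 + x) powr \<beta>)))"
      using \<open>B \<ge> 0\<close> by (intro AE_I2) (auto simp: indicator_def abs_mult mult_ac)
  qed
qed

lemma jacobi_hyp_orthogonal_power:
  fixes \<alpha> \<beta> :: real
  assumes ab: "\<alpha> > -1" "\<beta> > -1" and "j < n"
  shows "has_bochner_integral lborel
     (\<lambda>x. indicator {-1<..<1} x *\<^sub>R ((1 - x) powr \<alpha> * (1 + x) powr \<beta> *
        (poly (jacobi_hyp \<alpha> \<beta> n) x * (1 + x) ^ j))) 0"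
proof -
  let ?c = "\<lambda>m. jacobi_coeff \<alpha> \<beta> n m / 2 ^ m"
  let ?I = "\<lambda>m. 2 powr (\<alpha> + real m + (\<beta> + real j) + 1) * Beta (\<alpha> + real m + 1) (\<beta> + real j + 1)"
  let ?s = "\<alpha> + \<beta> + real j + 2"
  have "has_bochner_integral lborel
      (\<lambda>x. \<Sum>m\<le>n. ?c m * (indicator {-1<..<1} x *\<^sub>R
         ((1 - x) powr (\<alpha> + real m) * (1 + x) powr (\<beta> + real j)))) (\<Sum>m\<le>n. ?c m * ?I m)"
    using ab by (intro has_bochner_integral_sum has_bochner_integral_mult_right jacobi_weight_moment) auto
  also have "(\<lambda>x. \<Sum>m\<le>n. ?c m * (indicator {-1<..<1} x *\<^sub>R
         ((1 - x) powr (\<alpha> + real m) * (1 + x) powr (\<beta> + real j)))) =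
     (\<lambda>x. indicator {-1<..<1} x *\<^sub>R ((1 - x) powr \<alpha> * (1 + x) powr \<beta> *
        (poly (jacobi_hyp \<alpha> \<beta> n) x * (1 + x) ^ j)))"
    by (rule ext) (auto simp: indicator_def poly_jacobi_hyp sum_distrib_left sum_distrib_right
        powr_add powr_realpow power_divide intro!: sum.cong)
  also have "(\<Sum>m\<le>n. ?c m * ?I m) = 0"
  proof -
    let ?K = "2 powr (?s - 1) * (pochhammer (\<alpha> + 1) n / fact n) *
       (Gamma (\<alpha> + 1) * Gamma (\<beta> + real j + 1) / Gamma ?s)"
    let ?a = "real n + \<alpha> + \<beta> + 1"
    have s: "?s > 0" using ab by linarith
    have ni: "\<alpha> + 1 \<notin> \<int>\<^sub>\<le>\<^sub>0" "?s \<notin> \<int>\<^sub>\<le>\<^sub>0" using ab s by (auto dest: nonpos_Ints_nonpos)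
    have "?c m * ?I m = ?K *
        (pochhammer ?a m * pochhammer (- real n) m / (fact m * pochhammer ?s m))" for m
    proof -
      have p: "pochhammer (\<alpha> + 1) m > 0" "pochhammer ?s m > 0"
        using ab s by (auto intro!: pochhammer_pos)
      have G: "Gamma (\<alpha> + 1) > 0" "Gamma ?s > 0" using ab s by (auto intro!: Gamma_real_pos)
      have "Gamma (\<alpha> + real m + 1) = pochhammer (\<alpha> + 1) m * Gamma (\<alpha> + 1)"
        using pochhammer_Gamma[OF ni(1), of m] G by (simp add: field_simps)
      moreover have "Gamma (?s + real m) = pochhammer ?s m * Gamma ?s"
        using pochhammer_Gamma[OF ni(2), of m] G by (simp add: field_simps)
      moreover have "\<alpha> + real m + 1 + (\<beta> + real j + 1) = ?s + real m" by simp
      ultimately have B: "Beta (\<alpha> + real m + 1) (\<beta> + real j + 1) =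
         pochhammer (\<alpha> + 1) m * Gamma (\<alpha> + 1) * Gamma (\<beta> + real j + 1) / (pochhammer ?s m * Gamma ?s)"
        unfolding Beta_def by (simp only:)
      have "\<alpha> + real m + (\<beta> + real j) + 1 = (?s - 1) + real m" by simp
      hence P: "2 powr (\<alpha> + real m + (\<beta> + real j) + 1) = 2 powr (?s - 1) * 2 ^ m"
        by (simp only: powr_add powr_realpow)
      show ?thesis
        unfolding B P jacobi_coeff_def using p G by (simp add: divide_simps)
    qed
    hence "(\<Sum>m\<le>n. ?c m * ?I m) = ?K * (\<Sum>m\<in>{0..n}.
        pochhammer ?a m * pochhammer (- real n) m / (fact m * pochhammer ?s m))"
      by (simp only: sum_distrib_left atMost_atLeast0)
    also have "(\<Sum>m\<in>{0..n}.
        pochhammer ?a m * pochhammer (- real n) m / (fact m * pochhammer ?s m)) =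
        pochhammer (?s - ?a) n / pochhammer ?s n"
      using Vandermonde_pochhammer[of n ?s ?a] s by force
    also have "?s - ?a = - real (n - j - 1)"
      using \<open>j < n\<close> by (simp add: of_nat_diff)
    also have "pochhammer (- real (n - j - 1)) n = 0"
      using \<open>j < n\<close> by (intro pochhammer_of_nat_eq_0_lemma) auto
    finally show ?thesis by simp
  qed
  finally show ?thesis .
qed

lemma is_jacobi_poly_jacobi_hyp:
  assumes ab: "\<alpha> > -1" "\<beta> > -1"
  shows "is_jacobi_poly \<alpha> \<beta> n (jacobi_hyp \<alpha> \<beta> n)"
  unfolding is_jacobi_poly_def
proof (intro conjI allI impI)
  fix q :: "real poly" assume q: "degree q < n"
  define r where "r = q \<circ>\<^sub>p [:-1, 1:]"
  have dr: "degree r < n" using q by (simp add: r_def degree_pcompose)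
  have pq: "poly q x = (\<Sum>j\<le>degree r. coeff r j * (1 + x) ^ j)" for x
  proof -
    have "poly r (1 + x) = poly q x" by (simp add: r_def poly_pcompose)
    thus ?thesis by (simp add: poly_altdef)
  qed
  have "has_bochner_integral lborel (\<lambda>x. \<Sum>j\<le>degree r. coeff r j *
      (indicator {-1<..<1} x *\<^sub>R ((1 - x) powr \<alpha> * (1 + x) powr \<beta> *
        (poly (jacobi_hyp \<alpha> \<beta> n) x * (1 + x) ^ j)))) (\<Sum>j\<le>degree r. coeff r j * 0)"
    using dr
    by (intro has_bochner_integral_sum has_bochner_integral_mult_right
        jacobi_hyp_orthogonal_power ab) auto
  also have "(\<lambda>x. \<Sum>j\<le>degree r. coeff r j *
      (indicator {-1<..<1} x *\<^sub>R ((1 - x) powr \<alpha> * (1 + x) powr \<beta> *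
        (poly (jacobi_hyp \<alpha> \<beta> n) x * (1 + x) ^ j)))) =
      (\<lambda>x. indicator {-1<..<1} x *\<^sub>R ((1 - x) powr \<alpha> * (1 + x) powr \<beta> *
        (poly (jacobi_hyp \<alpha> \<beta> n) x * poly q x)))"
    unfolding pq by (simp add: sum_distrib_left mult_ac)
  finally show "(LBINT x:{-1<..<1}. (1 - x) powr \<alpha> * (1 + x) powr \<beta> *
      (poly (jacobi_hyp \<alpha> \<beta> n) x * poly q x)) = 0"
    by (simp add: has_bochner_integral_iff set_lebesgue_integral_def)
qed (use ab in \<open>auto simp: degree_jacobi_hyp poly_jacobi_hyp_1\<close>)

lemma jacobi_weight_definite:
  fixes p :: "real poly"
  assumes ab: "\<alpha> > -1" "\<beta> > -1"
    and "(LBINT x:{-1<..<1}. (1 - x) powr \<alpha> * (1 + x) powr \<beta> * (poly p x * poly p x)) = 0"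
  shows "p = 0"
proof (rule ccontr)
  assume "p \<noteq> 0"
  let ?f = "\<lambda>x. indicator {-1<..<1} x *\<^sub>R ((1 - x) powr \<alpha> * (1 + x) powr \<beta> * (poly p x * poly p x))"
  have "integrable lborel ?f" using jacobi_weight_integrable[OF ab, of "p * p"] by simp
  hence "AE x in lborel. ?f x = 0"
    using assms(3) by (subst integral_nonneg_eq_0_iff_AE[symmetric])
      (auto simp: set_lebesgue_integral_def indicator_def)
  moreover have "AE x in lborel. x \<notin> {x. poly p x = 0}"
    using poly_roots_finite[OF \<open>p \<noteq> 0\<close>]
    by (intro AE_not_in) (auto intro: finite_imp_null_set_lborel)
  ultimately have "AE x in lborel. x \<notin> {-1<..<1::real}"
    by eventually_elim (auto simp: indicator_def)
  hence "emeasure lborel {-1<..<1::real} = 0"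
    by (subst (asm) AE_iff_measurable[of "{-1<..<1}"]) auto
  thus False by simp
qed

lemma jacobi_poly_unique_existence:
  assumes ab: "\<alpha> > -1" "\<beta> > -1"
  shows "\<exists>!p. is_jacobi_poly \<alpha> \<beta> n p"
proof (rule ex1I)
  let ?J = "jacobi_hyp \<alpha> \<beta> n"
  let ?w = "\<lambda>x. (1 - x) powr \<alpha> * (1 + x) powr \<beta>"
  show J: "is_jacobi_poly \<alpha> \<beta> n ?J" by (rule is_jacobi_poly_jacobi_hyp[OF ab])
  fix p assume p: "is_jacobi_poly \<alpha> \<beta> n p"
  have J1: "poly ?J 1 > 0"
    using ab by (auto simp: poly_jacobi_hyp_1 intro!: divide_pos_pos pochhammer_pos)
  hence J0: "?J \<noteq> 0" by auto
  define c where "c = lead_coeff p / lead_coeff ?J"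
  define r where "r = p - smult c ?J"
  have deg: "degree p = n" "degree ?J = n" using p J by (auto simp: is_jacobi_poly_def)
  have "r = 0"
  proof (cases "n = 0")
    case True
    with deg obtain u v where "p = [:u:]" "?J = [:v:]" by (metis degree_eq_zeroE)
    with J0 show ?thesis by (simp add: r_def c_def)
  next
    case False
    have "coeff r n = 0" using deg J0 by (simp add: r_def c_def) (metis leading_coeff_0_iff)
    moreover have "degree r \<le> n"
      using deg unfolding r_def by (intro degree_diff_le) (auto intro: order.trans[OF degree_smult_le])
    ultimately have dr: "degree r < n" using False
      by (metis eq_zero_or_degree_less degree_0 gr0I)
    have ip: "set_integrable lborel {-1<..<1} (\<lambda>x. ?w x * (poly q x * poly r x))" for q
      using jacobi_weight_integrable[OF ab, of "q * r"] by (simp add: set_integrable_def)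
    have "(LBINT x:{-1<..<1}. ?w x * (poly r x * poly r x)) =
        (LBINT x:{-1<..<1}. ?w x * (poly p x * poly r x) - c * (?w x * (poly ?J x * poly r x)))"
      by (intro set_lebesgue_integral_cong) (auto simp: r_def algebra_simps)
    also have "\<dots> = (LBINT x:{-1<..<1}. ?w x * (poly p x * poly r x)) -
        c * (LBINT x:{-1<..<1}. ?w x * (poly ?J x * poly r x))"
      by (subst set_integral_diff) (auto intro: ip)
    also have "\<dots> = 0" using p J dr by (simp add: is_jacobi_poly_def)
    finally show ?thesis by (rule jacobi_weight_definite[OF ab])
  qed
  hence pc: "p = smult c ?J" by (simp add: r_def)
  have "poly p 1 = poly ?J 1" using p J by (simp add: is_jacobi_poly_def)
  hence "c = 1" using J1 pc by simp
  thus "p = ?J" using pc by simp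
qed

corollary jacobi_poly_eq_jacobi_hyp:
  assumes "\<alpha> > -1" "\<beta> > -1"
  shows "jacobi_poly \<alpha> \<beta> n = jacobi_hyp \<alpha> \<beta> n"
  unfolding jacobi_poly_def
  using jacobi_poly_unique_existence[OF assms] is_jacobi_poly_jacobi_hyp[OF assms]
  by (rule the1_equality)


section \<open>Square-integrable functions\<close>

text \<open>Elements of \<open>L\<^sup>2(M)\<close> are represented by square-integrable functions. No quotient is taken:
  two functions represent the same element iff they agree almost everywhere, and all notions below
  are invariant under such changes.\<close>

definition L2_space :: "'a measure \<Rightarrow> ('a \<Rightarrow> complex) set" where
  "L2_space M = {f \<in> borel_measurable M. integrable M (\<lambda>x. (norm (f x))\<^sup>2)}"

definition L2_inner :: "'a measure \<Rightarrow> ('a \<Rightarrow> complex) \<Rightarrow> ('a \<Rightarrow> complex) \<Rightarrow> complex" where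
  "L2_inner M f g = (LINT x|M. f x * cnj (g x))"

definition L2_norm :: "'a measure \<Rightarrow> ('a \<Rightarrow> complex) \<Rightarrow> real" where
  "L2_norm M f = sqrt (LINT x|M. (norm (f x))\<^sup>2)"

definition L2_closed_span :: "'a measure \<Rightarrow> (nat \<Rightarrow> 'a \<Rightarrow> complex) \<Rightarrow> ('a \<Rightarrow> complex) set" where
  "L2_closed_span M e =
     {f \<in> L2_space M. \<forall>\<epsilon>>0. \<exists>N c. L2_norm M (\<lambda>x. f x - (\<Sum>n<N. c n * e n x)) < \<epsilon>}"

definition L2_orthogonal_basis ::
  "'a measure \<Rightarrow> ('a \<Rightarrow> complex) set \<Rightarrow> (nat \<Rightarrow> 'a \<Rightarrow> complex) \<Rightarrow> bool" where
  "L2_orthogonal_basis M V e \<longleftrightarrow>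
     (\<forall>n. e n \<in> L2_space M \<and> L2_norm M (e n) \<noteq> 0) \<and>
     (\<forall>m n. m \<noteq> n \<longrightarrow> L2_inner M (e m) (e n) = 0) \<and>
     L2_closed_span M e = V"

definition L2_even :: "real measure \<Rightarrow> (real \<Rightarrow> complex) set" where
  "L2_even M = {f \<in> L2_space M. AE t in M. f (- t) = f t}"

definition L2_odd :: "real measure \<Rightarrow> (real \<Rightarrow> complex) set" where
  "L2_odd M = {f \<in> L2_space M. AE t in M. f (- t) = - f t}"


section \<open>The measure and the functions $Q^{(k)}_{n,\pm 1}$\<close>

definition \<mu> :: "real \<Rightarrow> real \<Rightarrow> real measure" where
  "\<mu> b \<iota> = density lborel
     (\<lambda>t. ennreal (2 powr (2 * b + \<iota>) * \<bar>sinh t\<bar> powr (2 * b) * \<bar>sinh (2 * t)\<bar> powr \<iota>))"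

definition w :: "real \<Rightarrow> nat \<Rightarrow> real \<Rightarrow> real" where
  "w \<sigma> k t = cosh t powr (- \<sigma>) * tanh t ^ (2 * k)"

definition \<sigma>\<^sub>0 :: "real \<Rightarrow> real \<Rightarrow> real \<Rightarrow> real" where
  "\<sigma>\<^sub>0 b \<iota> \<sigma> = \<sigma> - (\<iota> + b + 1)"

definition \<delta>\<^sub>0 :: "real \<Rightarrow> real \<Rightarrow> real" where
  "\<delta>\<^sub>0 b \<iota> = (\<iota> - 1) / 2 + b"

definition \<delta>\<^sub>1 :: "real \<Rightarrow> real \<Rightarrow> real" where
  "\<delta>\<^sub>1 b \<iota> = \<delta>\<^sub>0 b \<iota> + 1"

definition Q_even :: "real \<Rightarrow> real \<Rightarrow> real \<Rightarrow> nat \<Rightarrow> nat \<Rightarrow> real \<Rightarrow> complex" where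
  "Q_even b \<iota> \<sigma> k n t = complex_of_real
     (w \<sigma> k t * poly (jacobi_poly (\<sigma>\<^sub>0 b \<iota> \<sigma>) (\<delta>\<^sub>0 b \<iota> + 2 * real k) n) (2 * (tanh t)\<^sup>2 - 1))"

definition Q_odd :: "real \<Rightarrow> real \<Rightarrow> real \<Rightarrow> nat \<Rightarrow> nat \<Rightarrow> real \<Rightarrow> complex" where
  "Q_odd b \<iota> \<sigma> k n t = complex_of_real
     (w \<sigma> k t * poly (jacobi_poly (\<sigma>\<^sub>0 b \<iota> \<sigma>) (\<delta>\<^sub>1 b \<iota> + 2 * real k) n) (2 * (tanh t)\<^sup>2 - 1) * tanh t)"

text \<open>In the formula for the norm of \<open>Q\<^bsub>n,1\<^esub>\<close> the factor \<open>(2n+s) \<Gamma>(n+s)\<close>, where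
  \<open>s = 2k + \<sigma> - (\<iota>+1)/2\<close>, is undefined in exactly one admissible case, namely
  \<open>n = 0\<close> and \<open>s = 0\<close> (then \<open>k = 0\<close> and \<open>\<sigma> = (\<iota>+1)/2\<close>, which is possible
  when \<open>2b + \<iota> < 1\<close>). There it is to be read as its limit for \<open>s \<rightarrow> 0\<close>, which is 1,
  whereas \<open>0 * Gamma 0 = 0\<close> in HOL.\<close>

lemma mult_Gamma_tendsto_1: "((\<lambda>s::real. s * Gamma s) \<longlongrightarrow> 1) (at 0)"
proof -
  have "((\<lambda>s::real. Gamma (s + 1)) \<longlongrightarrow> Gamma (0 + 1)) (at 0)"
    by (intro tendsto_intros) (auto dest: nonpos_Ints_nonpos)
  moreover have "eventually (\<lambda>s::real. Gamma (s + 1) = s * Gamma s) (at 0)"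
  proof -
    have "Gamma (s + 1) = s * Gamma s" if "s \<noteq> 0" "dist s 0 < 1" for s :: real
    proof -
      have "s \<notin> \<int>\<^sub>\<le>\<^sub>0" using that by (auto elim!: nonpos_Ints_cases simp: dist_real_def)
      thus ?thesis by (rule Gamma_plus1)
    qed
    thus ?thesis unfolding eventually_at by (intro exI[of _ 1]) auto
  qed
  ultimately show ?thesis by (simp add: filterlim_cong)
qed

end

theory Submission
  imports Defs
begin

text \<open>
  Put \<open>x = 2 tanh\<^sup>2 t - 1\<close> and let \<open>v(t) = (cosh t)\<^sup>-\<^sup>\<sigma> (tanh t)\<^sup>j\<close> with \<open>j = 2k\<close> in the even and
  \<open>j = 2k + 1\<close> in the odd case. The image of \<open>v\<^sup>2 d\<mu>\<close> under \<open>t \<mapsto> x\<close> is a constant multiple of the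
  Jacobi weight \<open>(1 - x)\<^sup>\<alpha> (1 + x)\<^sup>\<beta>\<close> on \<open>(-1, 1)\<close> with \<open>\<beta> = \<delta>\<^sub>0 + j\<close>, so \<open>p \<mapsto> v(t) p(x)\<close> is, up to this
  constant, an isometry of the weighted space onto the functions of parity \<open>(-1)\<^sup>j\<close>. Hence
  orthogonality and norms are those of the Jacobi polynomials, and completeness is the density of
  polynomials in \<open>L\<^sup>2\<close> of a finite measure on a compact interval: truncate, approximate almost
  everywhere by continuous functions, and apply Weierstrass.
\<close>

section \<open>Norms of Jacobi polynomials\<close>

text \<open>The Chu--Vandermonde sum behind \<open>jacobi_hyp_orthogonal_power\<close>, at the first exponent for
  which it does not vanish.\<close>

lemma jacobi_hyp_integral_power:
  fixes \<alpha> \<beta> :: real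
  assumes ab: "\<alpha> > -1" "\<beta> > -1"
  shows "has_bochner_integral lborel
     (\<lambda>x. indicator {-1<..<1} x *\<^sub>R ((1 - x) powr \<alpha> * (1 + x) powr \<beta> *
        (poly (jacobi_hyp \<alpha> \<beta> n) x * (1 + x) ^ n)))
     (2 powr (\<alpha> + \<beta> + real n + 1) * Gamma (\<alpha> + real n + 1) * Gamma (\<beta> + real n + 1) /
        Gamma (\<alpha> + \<beta> + 2 * real n + 2))"
proof -
  let ?c = "\<lambda>m. jacobi_coeff \<alpha> \<beta> n m / 2 ^ m"
  let ?I = "\<lambda>m. 2 powr (\<alpha> + real m + (\<beta> + real n) + 1) * Beta (\<alpha> + real m + 1) (\<beta> + real n + 1)"
  let ?s = "\<alpha> + \<beta> + real n + 2"
  have s: "?s > 0" using ab by linarith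
  have ni: "\<alpha> + 1 \<notin> \<int>\<^sub>\<le>\<^sub>0" "?s \<notin> \<int>\<^sub>\<le>\<^sub>0" using ab s by (auto dest: nonpos_Ints_nonpos)
  have G: "Gamma (\<alpha> + 1) > 0" "Gamma ?s > 0" using ab s by (auto intro!: Gamma_real_pos)
  have Ga: "Gamma (\<alpha> + real m + 1) = pochhammer (\<alpha> + 1) m * Gamma (\<alpha> + 1)" for m
    using pochhammer_Gamma[OF ni(1), of m] G by (simp add: field_simps)
  have Gs: "Gamma (?s + real m) = pochhammer ?s m * Gamma ?s" for m
    using pochhammer_Gamma[OF ni(2), of m] G by (simp add: field_simps)
  have "has_bochner_integral lborel
      (\<lambda>x. \<Sum>m\<le>n. ?c m * (indicator {-1<..<1} x *\<^sub>R
         ((1 - x) powr (\<alpha> + real m) * (1 + x) powr (\<beta> + real n)))) (\<Sum>m\<le>n. ?c m * ?I m)"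
    using ab by (intro has_bochner_integral_sum has_bochner_integral_mult_right jacobi_weight_moment) auto
  also have "(\<lambda>x. \<Sum>m\<le>n. ?c m * (indicator {-1<..<1} x *\<^sub>R
         ((1 - x) powr (\<alpha> + real m) * (1 + x) powr (\<beta> + real n)))) =
     (\<lambda>x. indicator {-1<..<1} x *\<^sub>R ((1 - x) powr \<alpha> * (1 + x) powr \<beta> *
        (poly (jacobi_hyp \<alpha> \<beta> n) x * (1 + x) ^ n)))"
    by (rule ext) (auto simp: indicator_def poly_jacobi_hyp sum_distrib_left sum_distrib_right
        powr_add powr_realpow power_divide intro!: sum.cong)
  also have "(\<Sum>m\<le>n. ?c m * ?I m) =
    2 powr (\<alpha> + \<beta> + real n + 1) * Gamma (\<alpha> + real n + 1) * Gamma (\<beta> + real n + 1) /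
        Gamma (\<alpha> + \<beta> + 2 * real n + 2)"
  proof -
    let ?K = "2 powr (?s - 1) * (pochhammer (\<alpha> + 1) n / fact n) *
       (Gamma (\<alpha> + 1) * Gamma (\<beta> + real n + 1) / Gamma ?s)"
    let ?a = "real n + \<alpha> + \<beta> + 1"
    \<comment> \<open>The moments of the weight are Beta values. Their Gamma quotients turn into
      Pochhammer symbols in \<open>m\<close>, the factor \<open>(\<alpha> + 1)_m\<close> cancels
      against the Jacobi coefficient, and a multiple of a terminating 2F1 series at 1
      remains.\<close>
    have "?c m * ?I m = ?K *
        (pochhammer ?a m * pochhammer (- real n) m / (fact m * pochhammer ?s m))" for m
    proof -
      have p: "pochhammer (\<alpha> + 1) m > 0" "pochhammer ?s m > 0"
        using ab s by (auto intro!: pochhammer_pos)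
      have "\<alpha> + real m + 1 + (\<beta> + real n + 1) = ?s + real m" by simp
      hence B: "Beta (\<alpha> + real m + 1) (\<beta> + real n + 1) =
         pochhammer (\<alpha> + 1) m * Gamma (\<alpha> + 1) * Gamma (\<beta> + real n + 1) / (pochhammer ?s m * Gamma ?s)"
        unfolding Beta_def using Ga[of m] Gs[of m] by (simp only:)
      have "\<alpha> + real m + (\<beta> + real n) + 1 = (?s - 1) + real m" by simp
      hence P: "2 powr (\<alpha> + real m + (\<beta> + real n) + 1) = 2 powr (?s - 1) * 2 ^ m"
        by (simp only: powr_add powr_realpow)
      show ?thesis
        unfolding B P jacobi_coeff_def using p G by (simp add: divide_simps)
    qed
    hence "(\<Sum>m\<le>n. ?c m * ?I m) = ?K * (\<Sum>m\<in>{0..n}.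
        pochhammer ?a m * pochhammer (- real n) m / (fact m * pochhammer ?s m))"
      by (simp only: sum_distrib_left atMost_atLeast0)
    also have "(\<Sum>m\<in>{0..n}.
        pochhammer ?a m * pochhammer (- real n) m / (fact m * pochhammer ?s m)) =
        pochhammer (?s - ?a) n / pochhammer ?s n"
      using Vandermonde_pochhammer[of n ?s ?a] s by force
    \<comment> \<open>Here \<open>?s - ?a = 1\<close>. With an exponent \<open>j < n\<close> in
      place of \<open>n\<close> the difference is \<open>j + 1 - n\<close>, a nonpositive integer,
      and the symbol vanishes.\<close>
    also have "pochhammer (?s - ?a) n = fact n"
      by (simp add: pochhammer_fact)
    also have "?K * (fact n / pochhammer ?s n) =
        2 powr (?s - 1) * Gamma (\<alpha> + real n + 1) * Gamma (\<beta> + real n + 1) / Gamma (?s + real n)"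
      unfolding Ga Gs by (simp add: divide_simps)
    finally show ?thesis by (simp add: algebra_simps)
  qed
  finally show ?thesis .
qed

text \<open>Only the summand \<open>m = n\<close> reaches degree \<open>n\<close>. The sign of
  \<open>(-1/2) ^ n\<close> cancels against that of \<open>(-n)_n = (-1)^n n!\<close>, and
  \<open>(\<alpha> + 1)_n\<close> cancels between prefactor and denominator.\<close>

lemma coeff_jacobi_hyp:
  assumes "\<alpha> > -1"
  shows "coeff (jacobi_hyp \<alpha> \<beta> n) n = pochhammer (real n + \<alpha> + \<beta> + 1) n / (fact n * 2 ^ n)"
proof -
  have deg: "degree ([:1/2, -1/2:] ^ m :: real poly) = m" for m
    by (simp add: degree_power_eq)
  have lc: "coeff ([:1/2, -1/2:] ^ n :: real poly) n = (-1/2) ^ n"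
    using lead_coeff_power[of "[:1/2, -1/2:] :: real poly" n] by (simp only: deg) simp
  have p: "pochhammer (\<alpha> + 1) n > 0" using assms by (intro pochhammer_pos) auto
  have q: "pochhammer (- real n) n = (-1) ^ n * fact n"
    using pochhammer_same[of n, where 'a = real] by simp
  have "coeff (jacobi_hyp \<alpha> \<beta> n) n =
      (\<Sum>m\<le>n. jacobi_coeff \<alpha> \<beta> n m * coeff ([:1/2, -1/2:] ^ m) n)"
    by (simp add: jacobi_hyp_def coeff_sum)
  also have "\<dots> = (\<Sum>m\<le>n. if m = n then jacobi_coeff \<alpha> \<beta> n n * (-1/2) ^ n else 0)"
    by (intro sum.cong) (auto simp: coeff_eq_0 deg[simplified] lc[simplified])
  also have "\<dots> = jacobi_coeff \<alpha> \<beta> n n * (-1/2) ^ n" by simp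
  also have "\<dots> = pochhammer (real n + \<alpha> + \<beta> + 1) n / (fact n * 2 ^ n)"
    unfolding jacobi_coeff_def q using p
    by (simp add: divide_simps flip: power_mult_distrib)
  finally show ?thesis .
qed

text \<open>Away from the exceptional pair, \<open>(n + S)_n\<close> is a quotient of Gamma values
  whose numerator cancels by the functional equation. At \<open>n = 0\<close>, \<open>S = 0\<close>
  the left side is 1 while \<open>0 * Gamma 0\<close> is 0 in HOL; this is the origin of the case
  split in the norm formula.\<close>

lemma pochhammer_divide_Gamma:
  fixes S :: real
  assumes "S > -1"
  shows "pochhammer (real n + S) n / Gamma (S + 2 * real n + 1) =
    1 / (if n = 0 \<and> S = 0 then 1 else (2 * real n + S) * Gamma (real n + S))"
proof (cases "n = 0 \<and> S = 0")
  case False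
  \<comment> \<open>For \<open>n = 0\<close> the argument is \<open>S\<close> itself, which may lie
    in (-1, 0) but is no nonpositive integer; for \<open>n\<close> at least 1 it is
    positive.\<close>
  have ni: "real n + S \<notin> \<int>\<^sub>\<le>\<^sub>0"
  proof (cases "n = 0")
    case True
    with False assms show ?thesis by (auto elim!: nonpos_Ints_cases)
  next
    case False
    hence "real n \<ge> 1" by simp
    with assms have "real n + S > 0" by linarith
    thus ?thesis by (auto dest: nonpos_Ints_nonpos)
  qed
  have pos: "S + 2 * real n \<notin> \<int>\<^sub>\<le>\<^sub>0"
    using ni assms by (cases "n = 0") (auto dest!: nonpos_Ints_nonpos)
  have "Gamma (S + 2 * real n + 1) = (S + 2 * real n) * Gamma (S + 2 * real n)"
    using Gamma_plus1[OF pos] .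
  moreover have "pochhammer (real n + S) n = Gamma (S + 2 * real n) / Gamma (real n + S)"
    using pochhammer_Gamma[OF ni, of n] by (simp add: add_ac)
  moreover have "Gamma (S + 2 * real n) \<noteq> 0" using pos by (simp add: Gamma_eq_zero_iff)
  ultimately show ?thesis using False by (auto simp: add_ac)
qed auto

text \<open>One of the two factors may be replaced by its leading coefficient times
  \<open>(1 + x)^n\<close>: the two differ by a polynomial of lower degree, to which the Jacobi
  polynomial is orthogonal. The remaining integral is
  \<open>jacobi_hyp_integral_power\<close>.\<close>

lemma jacobi_hyp_norm:
  assumes ab: "\<alpha> > -1" "\<beta> > -1"
  defines "S \<equiv> \<alpha> + \<beta> + 1"
  shows "(LBINT x:{-1<..<1}. (1 - x) powr \<alpha> * (1 + x) powr \<beta> *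
      (poly (jacobi_hyp \<alpha> \<beta> n) x * poly (jacobi_hyp \<alpha> \<beta> n) x)) =
    2 powr S * (Gamma (real n + \<alpha> + 1) * Gamma (real n + \<beta> + 1) /
      (fact n * (if n = 0 \<and> S = 0 then 1 else (2 * real n + S) * Gamma (real n + S))))"
proof -
  let ?J = "jacobi_hyp \<alpha> \<beta> n"
  let ?w = "\<lambda>x::real. (1 - x) powr \<alpha> * (1 + x) powr \<beta>"
  let ?I = "\<lambda>q. LBINT x:{-1<..<1}. ?w x * (poly ?J x * poly q x)"
  define c where "c = coeff ?J n"
  define r where "r = ?J - smult c ([:1, 1:] ^ n)"
  have deg: "degree ([:1, 1:] ^ n :: real poly) = n" by (simp add: degree_power_eq)
  have lc: "coeff ([:1, 1:] ^ n :: real poly) n = 1"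
    using lead_coeff_power[of "[:1, 1:] :: real poly" n] by (simp only: deg) simp
  have "degree r \<le> n"
    using degree_jacobi_hyp[OF ab, of n] deg unfolding r_def
    by (intro degree_diff_le) (auto intro: order.trans[OF degree_smult_le])
  moreover have "coeff r n = 0" by (simp add: r_def c_def lc[simplified])
  \<comment> \<open>The alternative \<open>r = 0\<close> is what happens for \<open>n = 0\<close>,
    where no degree is smaller.\<close>
  ultimately have "r = 0 \<or> degree r < n"
    using eq_zero_or_degree_less by blast
  hence r0: "?I r = 0"
    using is_jacobi_poly_jacobi_hyp[OF ab, of n] by (auto simp: is_jacobi_poly_def)
  have ip: "set_integrable lborel {-1<..<1} (\<lambda>x. ?w x * (poly ?J x * poly q x))" for q
    using jacobi_weight_integrable[OF ab, of "?J * q"] by (simp add: set_integrable_def)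
  have "?I ?J = (LBINT x:{-1<..<1}. c * (?w x * (poly ?J x * poly ([:1, 1:] ^ n) x)) +
      ?w x * (poly ?J x * poly r x))"
    by (intro set_lebesgue_integral_cong) (auto simp: r_def algebra_simps)
  also have "\<dots> = c * ?I ([:1, 1:] ^ n) + ?I r"
    using ip[of "[:1, 1:] ^ n"] by (subst set_integral_add) (auto intro: ip)
  also have "?I ([:1, 1:] ^ n) = 2 powr (\<alpha> + \<beta> + real n + 1) * Gamma (\<alpha> + real n + 1) *
      Gamma (\<beta> + real n + 1) / Gamma (\<alpha> + \<beta> + 2 * real n + 2)"
    using jacobi_hyp_integral_power[OF ab, of n]
    by (simp add: has_bochner_integral_iff set_lebesgue_integral_def)
  also have "c * \<dots> + ?I r = 2 powr (S + real n) * Gamma (real n + \<alpha> + 1) *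
      Gamma (real n + \<beta> + 1) / (fact n * 2 ^ n) *
      (pochhammer (real n + S) n / Gamma (S + 2 * real n + 1))"
    unfolding c_def coeff_jacobi_hyp[OF ab(1)] r0 S_def by (simp add: add_ac)
  \<comment> \<open>The factor \<open>2 ^ n\<close> split off here cancels the one in the
    denominator of the leading coefficient.\<close>
  also have "2 powr (S + real n) = 2 powr S * 2 ^ n"
    by (simp add: powr_add powr_realpow)
  also have "pochhammer (real n + S) n / Gamma (S + 2 * real n + 1) =
      1 / (if n = 0 \<and> S = 0 then 1 else (2 * real n + S) * Gamma (real n + S))"
    using ab by (intro pochhammer_divide_Gamma) (auto simp: S_def)
  finally show ?thesis by simp
qed

section \<open>Density of polynomials\<close>

text \<open>A Lebesgue measurable function is a limit of continuous functions off a negligible set,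
  which is how \<open>measurable_on\<close> is defined. Clipping these at height \<open>B\<close>
  preserves continuity and the limit and supplies the constant majorant for dominated
  convergence.\<close>

lemma continuous_approx_bounded:
  fixes g :: "real \<Rightarrow> real"
  assumes fin: "finite_measure M" and sets: "sets M = sets borel"
    and ac: "absolutely_continuous lborel M"
    and meas: "g \<in> borel_measurable borel" and bd: "\<And>x. \<bar>g x\<bar> \<le> B" and "\<epsilon> > 0"
  obtains \<phi> where "continuous_on UNIV \<phi>" "\<And>x. \<bar>\<phi> x\<bar> \<le> B" "(LINT x|M. (g x - \<phi> x)\<^sup>2) < \<epsilon>"
proof -
  interpret finite_measure M by fact
  have [measurable_cong]: "sets M = sets borel" by fact
  note [measurable] = meas
  have B: "B \<ge> 0" using bd[of 0] by linarith
  have "g \<in> borel_measurable lebesgue"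
    using meas by (intro measurable_completion) auto
  hence "g measurable_on UNIV" by (intro lebesgue_measurable_imp_measurable_on) auto
  then obtain N h where N: "negligible N" and cont: "\<And>n. continuous_on UNIV (h n)"
    and lim: "\<And>x. x \<notin> N \<Longrightarrow> (\<lambda>n. h n x) \<longlonglongrightarrow> g x"
    unfolding measurable_on_def by auto
  define \<phi> where "\<phi> n x = max (- B) (min B (h n x))" for n :: nat and x
  have cont': "continuous_on UNIV (\<phi> n)" for n
    unfolding \<phi>_def by (intro continuous_intros cont)
  have [measurable]: "\<phi> n \<in> borel_measurable borel" for n
    using cont' by (rule borel_measurable_continuous_onI)
  have bd': "\<bar>\<phi> n x\<bar> \<le> B" for n x using B by (auto simp: \<phi>_def)
  have "N \<in> null_sets lebesgue" using N by (simp add: negligible_iff_null_sets)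
  \<comment> \<open>The exceptional set is only Lebesgue null; a Borel null set around it is needed
    for absolute continuity to apply.\<close>
  then obtain N' where N': "N' \<in> null_sets lborel" "N \<subseteq> N'"
    by (metis null_sets_completion_iff2)
  have "AE x in M. x \<notin> N'"
    using N' ac by (intro AE_not_in) (auto simp: absolutely_continuous_def)
  hence "AE x in M. (\<lambda>n. (g x - \<phi> n x)\<^sup>2) \<longlonglongrightarrow> 0"
  proof eventually_elim
    case (elim x)
    hence "(\<lambda>n. \<phi> n x) \<longlonglongrightarrow> max (- B) (min B (g x))"
      unfolding \<phi>_def using N' by (intro tendsto_intros lim) auto
    also have "max (- B) (min B (g x)) = g x" using bd[of x] by linarith
    finally have "(\<lambda>n. (g x - \<phi> n x)\<^sup>2) \<longlonglongrightarrow> (g x - g x)\<^sup>2" by (intro tendsto_intros)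
    thus ?case by simp
  qed
  moreover have "norm ((g x - \<phi> n x)\<^sup>2) \<le> (2 * B)\<^sup>2" for n x
  proof -
    have "\<bar>g x - \<phi> n x\<bar> \<le> \<bar>2 * B\<bar>" using bd[of x] bd'[of n x] by linarith
    thus ?thesis unfolding abs_le_square_iff by simp
  qed
  ultimately have "(\<lambda>n. LINT x|M. (g x - \<phi> n x)\<^sup>2) \<longlonglongrightarrow> (LINT x|M. 0)"
    by (intro integral_dominated_convergence[where w = "\<lambda>_. (2 * B)\<^sup>2"]) auto
  hence "eventually (\<lambda>n. (LINT x|M. (g x - \<phi> n x)\<^sup>2) < \<epsilon>) sequentially"
    using \<open>\<epsilon> > 0\<close> by (intro order_tendstoD(2)) auto
  then obtain n where "(LINT x|M. (g x - \<phi> n x)\<^sup>2) < \<epsilon>"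
    by (auto simp: eventually_sequentially)
  thus ?thesis using that[OF cont' bd'] by blast
qed

text \<open>The truncation at height \<open>n\<close> equals \<open>g x\<close> as soon as
  \<open>n\<close> exceeds \<open>\<bar>g x\<bar>\<close>, and the squared error is dominated by the
  square of \<open>g\<close>.\<close>

lemma bounded_approx_L2:
  fixes g :: "real \<Rightarrow> real"
  assumes [measurable]: "g \<in> borel_measurable M" and int: "integrable M (\<lambda>x. (g x)\<^sup>2)" and "\<epsilon> > 0"
  obtains B where "B \<ge> 0" "(LINT x|M. (g x - max (- B) (min B (g x)))\<^sup>2) < \<epsilon>"
proof -
  define h where "h n x = max (- real n) (min (real n) (g x))" for n :: nat and x
  have [measurable]: "h n \<in> borel_measurable M" for n unfolding h_def by measurable
  have "(\<lambda>n. (g x - h n x)\<^sup>2) \<longlonglongrightarrow> 0" for x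
  proof (rule tendsto_eventually)
    obtain m where "\<bar>g x\<bar> \<le> real m" using real_arch_simple by blast
    thus "eventually (\<lambda>n. (g x - h n x)\<^sup>2 = 0) sequentially"
      unfolding eventually_sequentially h_def by (intro exI[of _ m]) (auto simp: abs_le_iff)
  qed
  moreover have "norm ((g x - h n x)\<^sup>2) \<le> (g x)\<^sup>2" for n x
  proof -
    have "\<bar>g x - h n x\<bar> \<le> \<bar>g x\<bar>" unfolding h_def by linarith
    thus ?thesis by (simp add: abs_le_square_iff)
  qed
  ultimately have "(\<lambda>n. LINT x|M. (g x - h n x)\<^sup>2) \<longlonglongrightarrow> (LINT x|M. 0)"
    by (intro integral_dominated_convergence[where w = "\<lambda>x. (g x)\<^sup>2"]) (auto intro: int)
  hence "eventually (\<lambda>n. (LINT x|M. (g x - h n x)\<^sup>2) < \<epsilon>) sequentially"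
    using \<open>\<epsilon> > 0\<close> by (intro order_tendstoD(2)) auto
  then obtain n where "(LINT x|M. (g x - h n x)\<^sup>2) < \<epsilon>"
    by (auto simp: eventually_sequentially)
  thus ?thesis using that[of "real n"] by (simp add: h_def)
qed

lemma Weierstrass_poly:
  fixes f :: "real \<Rightarrow> real"
  assumes "compact S" "continuous_on S f" "\<epsilon> > 0"
  obtains p where "\<And>x. x \<in> S \<Longrightarrow> \<bar>f x - poly p x\<bar> < \<epsilon>"
proof -
  obtain g where g: "real_polynomial_function g" "\<And>x. x \<in> S \<Longrightarrow> \<bar>f x - g x\<bar> < \<epsilon>"
    using Stone_Weierstrass_real_polynomial_function[OF assms] by blast
  then obtain a n where "g = (\<lambda>x. \<Sum>i\<le>n. a i * x ^ i)"
    using real_polynomial_function_iff_sum by blast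
  hence "g x = poly (\<Sum>i\<le>n. monom (a i) i) x" for x by (simp add: poly_sum poly_monom)
  thus ?thesis using g that by metis
qed

text \<open>Truncation, continuous approximation and Weierstrass each contribute a squared error
  below \<open>\<epsilon> / 9\<close>; the factor 3 from squaring a sum of three terms brings the
  total to \<open>\<epsilon>\<close>. Integrability of the error is part of the conclusion so that
  errors of real and imaginary parts can later be added.\<close>

lemma polynomials_dense_L2_real:
  fixes g :: "real \<Rightarrow> real"
  assumes fin: "finite_measure M" and sets: "sets M = sets borel"
    and ac: "absolutely_continuous lborel M" and bounded: "AE x in M. x \<in> {a..b}"
    and meas: "g \<in> borel_measurable borel" and int: "integrable M (\<lambda>x. (g x)\<^sup>2)" and "\<epsilon> > 0"
  obtains p where "integrable M (\<lambda>x. (g x - poly p x)\<^sup>2)" "(LINT x|M. (g x - poly p x)\<^sup>2) < \<epsilon>"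
proof -
  interpret finite_measure M by fact
  have [measurable_cong]: "sets M = sets borel" by fact
  note [measurable] = meas
  have [measurable]: "poly p \<in> borel_measurable borel" for p :: "real poly"
    by (intro borel_measurable_continuous_onI continuous_intros)
  obtain B where B: "B \<ge> 0" "(LINT x|M. (g x - max (- B) (min B (g x)))\<^sup>2) < \<epsilon> / 9"
    using bounded_approx_L2[of g M "\<epsilon> / 9"] int \<open>\<epsilon> > 0\<close> by auto
  define h where "h x = max (- B) (min B (g x))" for x
  have h [measurable]: "h \<in> borel_measurable borel" unfolding h_def by measurable
  have hB: "\<bar>h x\<bar> \<le> B" for x using B(1) by (auto simp: h_def)
  obtain \<phi> where \<phi>: "continuous_on UNIV \<phi>" "\<And>x. \<bar>\<phi> x\<bar> \<le> B" "(LINT x|M. (h x - \<phi> x)\<^sup>2) < \<epsilon> / 9"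
    using continuous_approx_bounded[OF fin sets ac h hB, of "\<epsilon> / 9"] \<open>\<epsilon> > 0\<close> by auto
  have [measurable]: "\<phi> \<in> borel_measurable borel"
    using \<phi>(1) by (rule borel_measurable_continuous_onI)
  \<comment> \<open>Integrated over all of \<open>M\<close>, the constant \<open>\<delta>\<close>
    stays below \<open>\<epsilon> / 9\<close>; the summand 1 keeps the denominator positive if
    \<open>M\<close> has mass zero.\<close>
  define \<delta> where "\<delta> = \<epsilon> / (9 * (measure M (space M) + 1))"
  have "\<delta> > 0" using \<open>\<epsilon> > 0\<close> by (simp add: \<delta>_def add_nonneg_pos)
  obtain p where p: "\<And>x. x \<in> {a..b} \<Longrightarrow> \<bar>\<phi> x - poly p x\<bar> < sqrt \<delta>"
    using Weierstrass_poly[of "{a..b}" \<phi> "sqrt \<delta>"] \<phi>(1) \<open>\<delta> > 0\<close>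
    by (auto intro: continuous_on_subset)
  \<comment> \<open>The polynomial is controlled only on \<open>{a..b}\<close>, which carries all of
    the mass.\<close>
  have p': "AE x in M. (\<phi> x - poly p x)\<^sup>2 \<le> \<delta>"
    using bounded
  proof eventually_elim
    case (elim x)
    from p[OF this] have "\<bar>\<phi> x - poly p x\<bar>\<^sup>2 \<le> (sqrt \<delta>)\<^sup>2" by (intro power_mono) auto
    thus ?case using \<open>\<delta> > 0\<close> by simp
  qed
  have i1: "integrable M (\<lambda>x. (g x - h x)\<^sup>2)"
  proof (rule Bochner_Integration.integrable_bound[OF int])
    have "\<bar>g x - h x\<bar> \<le> \<bar>g x\<bar>" for x unfolding h_def using B(1) by linarith
    thus "AE x in M. norm ((g x - h x)\<^sup>2) \<le> norm ((g x)\<^sup>2)"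
      by (simp add: abs_le_square_iff)
  qed auto
  have i2: "integrable M (\<lambda>x. (h x - \<phi> x)\<^sup>2)"
  proof (rule integrable_const_bound[where B = "(2 * B)\<^sup>2"])
    have "\<bar>h x - \<phi> x\<bar> \<le> \<bar>2 * B\<bar>" for x using hB[of x] \<phi>(2)[of x] by linarith
    thus "AE x in M. norm ((h x - \<phi> x)\<^sup>2) \<le> (2 * B)\<^sup>2"
      unfolding abs_le_square_iff by simp
  qed auto
  have i3: "integrable M (\<lambda>x. (\<phi> x - poly p x)\<^sup>2)"
    using p' by (intro integrable_const_bound[where B = \<delta>]) auto
  have "(LINT x|M. (\<phi> x - poly p x)\<^sup>2) \<le> (LINT x|M. \<delta>)"
    using p' by (intro integral_mono_AE i3) auto
  also have "\<dots> < \<epsilon> / 9"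
    using \<open>\<epsilon> > 0\<close> measure_nonneg[of M "space M"]
    by (simp add: \<delta>_def divide_simps add_nonneg_pos)
  finally have e3: "(LINT x|M. (\<phi> x - poly p x)\<^sup>2) < \<epsilon> / 9" .
  let ?r = "\<lambda>x. 3 * ((g x - h x)\<^sup>2 + (h x - \<phi> x)\<^sup>2 + (\<phi> x - poly p x)\<^sup>2)"
  have le: "(g x - poly p x)\<^sup>2 \<le> ?r x" for x
  proof -
    \<comment> \<open>The difference of the two sides is the sum of the squares of
      \<open>u - v\<close>, \<open>v - z\<close> and \<open>u - z\<close>.\<close>
    have "(u + v + z)\<^sup>2 \<le> 3 * (u\<^sup>2 + v\<^sup>2 + z\<^sup>2)" for u v z :: real
      using sum_squares_ge_zero[of "u - v" "v - z"] zero_le_power2[of "u - z"]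
      by (simp add: power2_eq_square algebra_simps)
    from this[of "g x - h x" "h x - \<phi> x" "\<phi> x - poly p x"] show ?thesis by simp
  qed
  have ir: "integrable M ?r"
    by (intro integrable_mult_right Bochner_Integration.integrable_add i1 i2 i3)
  have int: "integrable M (\<lambda>x. (g x - poly p x)\<^sup>2)"
    by (rule Bochner_Integration.integrable_bound[OF ir]) (use le in \<open>auto intro: order.trans[OF _ abs_ge_self]\<close>)
  have "(LINT x|M. (g x - poly p x)\<^sup>2) \<le> (LINT x|M. ?r x)"
    by (intro integral_mono int ir le)
  also have "\<dots> = 3 * ((LINT x|M. (g x - h x)\<^sup>2) + (LINT x|M. (h x - \<phi> x)\<^sup>2) +
      (LINT x|M. (\<phi> x - poly p x)\<^sup>2))"
    using i1 i2 i3 by simp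
  also have "\<dots> < 3 * (\<epsilon> / 9 + \<epsilon> / 9 + \<epsilon> / 9)"
    using B(2) \<phi>(3) e3 by (intro mult_strict_left_mono add_strict_mono) (auto simp: h_def)
  finally show ?thesis using that int by simp
qed

section \<open>The substitution $x = 2 \tanh^2 t - 1$\<close>

lemma tanh_artanh_real:
  fixes x :: real
  assumes "\<bar>x\<bar> < 1"
  shows "tanh (artanh x) = x"
proof -
  have x: "1 + x > 0" "1 - x > 0" using assms by auto
  have "exp (- 2 * artanh x) = inverse ((1 + x) / (1 - x))"
    using x by (simp add: artanh_def exp_minus)
  also have "\<dots> = (1 - x) / (1 + x)" by simp
  finally have "tanh (artanh x) = (1 - (1 - x) / (1 + x)) / (1 + (1 - x) / (1 + x))"
    unfolding tanh_real_altdef by simp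
  also have "\<dots> = x" using x by (simp add: divide_simps)
  finally show ?thesis .
qed

definition tanh_var :: "real \<Rightarrow> real" where
  "tanh_var t = 2 * (tanh t)\<^sup>2 - 1"

text \<open>The nonnegative branch of the inverse: as \<open>tanh_var\<close> is even, it can
  recover only the absolute value of \<open>t\<close>.\<close>

definition tanh_var_inv :: "real \<Rightarrow> real" where
  "tanh_var_inv x = artanh (sqrt ((1 + x) / 2))"

lemma tanh_var_minus [simp]: "tanh_var (- t) = tanh_var t"
  by (simp add: tanh_var_def)

lemma tanh_var_less_1: "tanh_var t < 1"
proof -
  have "(tanh t)\<^sup>2 < 1" using tanh_real_bounds[of t] by (simp add: abs_square_less_1 abs_less_iff)
  thus ?thesis by (simp add: tanh_var_def)
qed

lemma tanh_var_inv_tanh_var: "t > 0 \<Longrightarrow> tanh_var_inv (tanh_var t) = t"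
  by (simp add: tanh_var_def tanh_var_inv_def artanh_tanh_real)

lemma tanh_var_tanh_var_inv:
  assumes "x \<in> {-1<..<1}"
  shows "tanh_var_inv x > 0" "tanh_var (tanh_var_inv x) = x"
proof -
  have s: "0 < sqrt ((1 + x) / 2)" "sqrt ((1 + x) / 2) < 1" using assms by auto
  hence t: "tanh (tanh_var_inv x) = sqrt ((1 + x) / 2)"
    unfolding tanh_var_inv_def by (intro tanh_artanh_real) auto
  with s have "tanh (tanh_var_inv x) > 0" by simp
  thus "tanh_var_inv x > 0" by simp
  show "tanh_var (tanh_var_inv x) = x"
    using assms by (simp add: tanh_var_def t field_simps)
qed

lemma image_tanh_var: "tanh_var ` {0<..} = {-1<..<1}"
proof (intro equalityI subsetI)
  fix x assume "x \<in> tanh_var ` {0<..}"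
  thus "x \<in> {-1<..<1}" using tanh_var_less_1 by (auto simp: tanh_var_def)
next
  fix x :: real assume "x \<in> {-1<..<1}"
  from tanh_var_tanh_var_inv[OF this] show "x \<in> tanh_var ` {0<..}"
    by (intro image_eqI[of _ _ "tanh_var_inv x"]) auto
qed

lemma borel_measurable_tanh_var [measurable]:
  "tanh_var \<in> borel_measurable borel" "tanh_var_inv \<in> borel_measurable borel"
  unfolding tanh_var_def [abs_def] tanh_var_inv_def [abs_def] artanh_def
  by (auto intro!: borel_measurable_continuous_onI continuous_intros)

lemma borel_measurable_hyperbolic [measurable]:
  "(sinh :: real \<Rightarrow> real) \<in> borel_measurable borel"
  "(cosh :: real \<Rightarrow> real) \<in> borel_measurable borel"
  "(tanh :: real \<Rightarrow> real) \<in> borel_measurable borel"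
  by (auto intro!: borel_measurable_continuous_onI continuous_intros)

text \<open>On the positive half-line \<open>tanh_var\<close> is injective with image (-1, 1) and
  derivative \<open>4 tanh t (1 - tanh^2 t)\<close>, so this is the substitution rule applied to
  indicator functions.\<close>

lemma distr_tanh_var:
  "distr (density lborel (\<lambda>t. ennreal (indicator {0<..} t * (4 * tanh t * (1 - (tanh t)\<^sup>2))))) borel
     tanh_var = density lborel (indicator {-1<..<1})" (is "?L = ?R")
proof (rule measure_eqI)
  fix A assume "A \<in> sets ?L"
  hence A [measurable]: "A \<in> sets borel" by simp
  let ?d = "\<lambda>t::real. 4 * tanh t * (1 - (tanh t)\<^sup>2)"
  let ?f = "indicator A :: real \<Rightarrow> real"
  have nn: "?d t \<ge> 0" if "t > 0" for t :: real
    using that tanh_var_less_1[of t] by (simp add: tanh_var_def)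
  have deriv: "(tanh_var has_field_derivative ?d t) (at t within {0<..})" for t
    unfolding tanh_var_def [abs_def] by (auto intro!: derivative_eq_intros)
  have inj: "inj_on tanh_var {0<..}"
    by (rule inj_on_inverseI[of _ tanh_var_inv]) (simp add: tanh_var_inv_tanh_var)
  have tA [measurable]: "tanh_var -` A \<in> sets borel"
    using measurable_sets_borel[OF borel_measurable_tanh_var(1) A] .
  have "emeasure lborel (A \<inter> {-1<..<1}) \<le> emeasure lborel {-1<..<1::real}"
    by (intro emeasure_mono) auto
  also have "\<dots> < \<infinity>" by simp
  finally have fin: "emeasure lborel (A \<inter> {-1<..<1}) < \<infinity>" .
  have "integrable lborel (indicator (A \<inter> {-1<..<1}) :: real \<Rightarrow> real)"
    using fin by (intro integrable_real_indicator) auto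
  also have "indicator (A \<inter> {-1<..<1}) = (\<lambda>x. indicator {-1<..<1} x *\<^sub>R ?f x)"
    by (auto simp: indicator_def)
  finally have si: "set_integrable lborel {-1<..<1} ?f"
    by (simp only: set_integrable_def)
  \<comment> \<open>The substitution theorem is about Lebesgue measure;
    \<open>integrable_completion\<close> passes there and back, the integrands being Borel.\<close>
  hence "?f absolutely_integrable_on {-1<..<1}"
    unfolding set_integrable_def by (subst integrable_completion) auto
  moreover have "integral {-1<..<1} ?f = measure lborel (A \<inter> {-1<..<1})"
    using set_borel_integral_eq_integral(2)[OF si]
    by (simp add: set_lebesgue_integral_def indicator_inter_arith[symmetric] Int_commute)
  ultimately have cv: "(\<lambda>t. \<bar>?d t\<bar> * ?f (tanh_var t)) absolutely_integrable_on {0<..}"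
     "integral {0<..} (\<lambda>t. \<bar>?d t\<bar> * ?f (tanh_var t)) = measure lborel (A \<inter> {-1<..<1})"
    using has_absolute_integral_change_of_variables_1'[OF _ deriv inj, of ?f]
    by (auto simp: image_tanh_var)
  have si': "set_integrable lborel {0<..} (\<lambda>t. \<bar>?d t\<bar> * ?f (tanh_var t))"
    using cv(1) unfolding set_integrable_def by (subst (asm) integrable_completion) auto
  have "emeasure ?L A = (\<integral>\<^sup>+t. ennreal (indicator {0<..} t *\<^sub>R (\<bar>?d t\<bar> * ?f (tanh_var t))) \<partial>lborel)"
    using nn by (subst emeasure_distr, simp, simp, subst emeasure_density)
      (auto intro!: nn_integral_cong simp: indicator_def)
  also have "\<dots> = ennreal (measure lborel (A \<inter> {-1<..<1}))"
    using si' set_borel_integral_eq_integral(2)[OF si'] cv(2)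
    by (subst nn_integral_eq_integral) (auto simp: set_integrable_def set_lebesgue_integral_def)
  also have "\<dots> = emeasure lborel (A \<inter> {-1<..<1})"
    using fin by (simp add: emeasure_eq_ennreal_measure)
  also have "\<dots> = emeasure ?R A"
    by (simp add: emeasure_density indicator_inter_arith[symmetric] Int_commute)
  finally show "emeasure ?L A = emeasure ?R A" .
qed simp

lemma nn_integral_even:
  fixes F :: "real \<Rightarrow> ennreal"
  assumes [measurable]: "F \<in> borel_measurable borel" and even: "\<And>t. F (- t) = F t"
  shows "(\<integral>\<^sup>+t. F t \<partial>lborel) = 2 * (\<integral>\<^sup>+t. F t * indicator {0<..} t \<partial>lborel)"
proof -
  have "AE t in lborel. t \<noteq> (0::real)" by (rule AE_lborel_singleton)
  hence "(\<integral>\<^sup>+t. F t \<partial>lborel) =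
      (\<integral>\<^sup>+t. F t * indicator {0<..} t + F t * indicator {..<0} t \<partial>lborel)"
    by (intro nn_integral_cong_AE) (auto elim!: eventually_mono simp: indicator_def)
  also have "\<dots> = (\<integral>\<^sup>+t. F t * indicator {0<..} t \<partial>lborel) + (\<integral>\<^sup>+t. F t * indicator {..<0} t \<partial>lborel)"
    by (intro nn_integral_add) auto
  also have "(\<integral>\<^sup>+t. F t * indicator {..<0} t \<partial>lborel) = (\<integral>\<^sup>+t. F t * indicator {0<..} t \<partial>lborel)"
    by (subst nn_integral_real_affine[where c = "-1" and t = 0])
      (auto simp: even indicator_def intro!: nn_integral_cong)
  finally show ?thesis by (simp add: mult_2)
qed

text \<open>Both half-lines are mapped onto (-1, 1) and carry equal mass because \<open>W\<close>
  and \<open>tanh_var\<close> are even; this gives the factor 2. On the positive half-line the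
  Jacobian in \<open>W\<close> is absorbed by \<open>distr_tanh_var\<close>.\<close>

lemma distr_tanh_var_density:
  fixes W g :: "real \<Rightarrow> real"
  assumes [measurable]: "W \<in> borel_measurable borel" "g \<in> borel_measurable borel"
    and even: "\<And>t. W (- t) = W t"
    and W: "\<And>t. t > 0 \<Longrightarrow> W t = g (tanh_var t) * (4 * tanh t * (1 - (tanh t)\<^sup>2))"
    and nonneg: "\<And>x. g x \<ge> 0"
  shows "distr (density lborel (\<lambda>t. ennreal (W t))) borel tanh_var =
    density lborel (\<lambda>x. ennreal (2 * (indicator {-1<..<1} x * g x)))" (is "?L = ?R")
proof (rule measure_eqI)
  fix A assume "A \<in> sets ?L"
  hence A [measurable]: "A \<in> sets borel" by simp
  let ?d = "\<lambda>t::real. 4 * tanh t * (1 - (tanh t)\<^sup>2)"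
  have tA [measurable]: "tanh_var -` A \<in> sets borel"
    using measurable_sets_borel[OF borel_measurable_tanh_var(1) A] .
  let ?G = "\<lambda>x. ennreal (2 * g x) * indicator A x"
  have d: "?d t \<ge> 0" if "t > 0" for t :: real
    using that tanh_var_less_1[of t] by (simp add: tanh_var_def)
  have "emeasure ?L A = (\<integral>\<^sup>+t. ennreal (W t) * indicator A (tanh_var t) \<partial>lborel)"
    by (subst emeasure_distr, simp, simp, subst emeasure_density)
      (auto intro!: nn_integral_cong simp: indicator_def)
  also have "\<dots> = (\<integral>\<^sup>+t. 2 * (ennreal (W t) * indicator A (tanh_var t) * indicator {0<..} t) \<partial>lborel)"
    by (subst nn_integral_even) (auto simp: even nn_integral_cmult)
  also have "\<dots> = (\<integral>\<^sup>+t. ennreal (indicator {0<..} t * ?d t) * ?G (tanh_var t) \<partial>lborel)"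
  proof (intro nn_integral_cong)
    fix t :: real
    show "2 * (ennreal (W t) * indicator A (tanh_var t) * indicator {0<..} t) =
        ennreal (indicator {0<..} t * ?d t) * ?G (tanh_var t)"
    proof (cases "t > 0")
      case True
      have "ennreal (W t) = ennreal (g (tanh_var t)) * ennreal (?d t)"
        unfolding W[OF True] by (rule ennreal_mult[OF nonneg d[OF True]])
      moreover have "ennreal (2 * g (tanh_var t)) = 2 * ennreal (g (tanh_var t))"
        using nonneg by (simp add: ennreal_mult)
      ultimately show ?thesis using True by (simp add: mult_ac del: ennreal_mult')
    qed simp
  qed
  also have "\<dots> = (\<integral>\<^sup>+x. ?G x \<partial>density lborel (indicator {-1<..<1}))"
    unfolding distr_tanh_var[symmetric]
    by (subst nn_integral_distr, simp, simp, subst nn_integral_density) auto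
  also have "\<dots> = emeasure ?R A"
    by (subst nn_integral_density, simp, simp, subst emeasure_density)
      (auto intro!: nn_integral_cong simp: indicator_def)
  finally show "emeasure ?L A = emeasure ?R A" .
qed simp

text \<open>In terms of \<open>A = ln (tanh t)\<close> and \<open>C = ln (cosh t)\<close> every
  factor is the exponential of a linear form in \<open>A\<close>, \<open>C\<close> and
  \<open>ln 2\<close>, so the identity reduces to comparing exponents.\<close>

lemma weight_tanh_var:
  fixes b \<iota> \<sigma> :: real and j :: nat
  assumes "t > 0"
  defines "\<alpha> \<equiv> \<sigma> - (\<iota> + b + 1)" and "\<beta> \<equiv> (\<iota> - 1) / 2 + b + real j"
  shows "2 powr (2 * b + \<iota>) * \<bar>sinh t\<bar> powr (2 * b) * \<bar>sinh (2 * t)\<bar> powr \<iota> *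
      (cosh t powr (- \<sigma>) * tanh t ^ j)\<^sup>2 =
    2 powr (2 * (\<iota> + b) - (\<alpha> + \<beta> + 1) - 1) *
      ((1 - tanh_var t) powr \<alpha> * (1 + tanh_var t) powr \<beta>) * (4 * tanh t * (1 - (tanh t)\<^sup>2))"
proof -
  define A where "A = ln (tanh t)"
  define C where "C = ln (cosh t)"
  have a: "tanh t = exp A" using assms(1) by (simp add: A_def)
  have c: "cosh t = exp C" by (simp add: C_def)
  have s: "sinh t = exp (A + C)"
    using a c by (simp add: tanh_def exp_add field_simps)
  have t2: "1 - (tanh t)\<^sup>2 = exp (- 2 * C)"
  proof -
    have "1 - (tanh t)\<^sup>2 = ((cosh t)\<^sup>2 - (sinh t)\<^sup>2) / (cosh t)\<^sup>2"
      by (simp add: tanh_def field_simps)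
    also have "\<dots> = 1 / (cosh t)\<^sup>2" by (simp add: cosh_square_eq)
    finally show ?thesis by (simp add: c exp_minus power2_eq_square field_simps flip: exp_add)
  qed
  have s2: "sinh (2 * t) = exp (ln 2 + A + 2 * C)"
    unfolding sinh_double s c by (simp add: exp_add exp_double power2_eq_square)
  have m: "1 - tanh_var t = exp (ln 2 - 2 * C)"
  proof -
    have "1 - tanh_var t = 2 * (1 - (tanh t)\<^sup>2)" by (simp add: tanh_var_def)
    thus ?thesis unfolding t2 by (simp add: exp_diff exp_minus field_simps)
  qed
  have p: "1 + tanh_var t = exp (ln 2 + 2 * A)"
    by (simp add: tanh_var_def a exp_add exp_double)
  have four: "4 * tanh t = exp (2 * ln 2 + A)"
    by (simp add: a exp_add exp_double)
  have two: "2 powr x = exp (x * ln 2)" for x :: real by (simp add: powr_def)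
  have pw: "exp x powr y = exp (y * x)" for x y :: real by (simp add: powr_def)
  have tj: "tanh t ^ j = exp (real j * A)" by (simp add: a exp_of_nat_mult)
  \<comment> \<open>The coefficients of \<open>A\<close> agree since
    \<open>2 \<beta> + 1 = 2 b + \<iota> + 2 j\<close>, those of \<open>C\<close> since
    \<open>\<alpha> + 1 = \<sigma> - \<iota> - b\<close>; the coefficient of \<open>ln 2\<close>
    fixes the constant in front.\<close>
  show ?thesis
    unfolding t2 four tj m p s2 s c two abs_exp_cancel pw
    unfolding power2_eq_square
    by (simp add: \<alpha>_def \<beta>_def field_simps flip: exp_add)
qed

section \<open>Transfer of orthogonal bases\<close>

lemma power2_L2_norm: "(L2_norm M f)\<^sup>2 = (LINT x|M. (norm (f x))\<^sup>2)"
  by (simp add: L2_norm_def)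

lemma L2_space_diff:
  assumes "f \<in> L2_space M" "g \<in> L2_space M"
  shows "(\<lambda>x. f x - g x) \<in> L2_space M"
proof -
  have [measurable]: "f \<in> borel_measurable M" "g \<in> borel_measurable M"
    using assms by (auto simp: L2_space_def)
  have "integrable M (\<lambda>x. 2 * ((norm (f x))\<^sup>2 + (norm (g x))\<^sup>2))"
    using assms by (auto simp: L2_space_def)
  hence "integrable M (\<lambda>x. (norm (f x - g x))\<^sup>2)"
  proof (rule Bochner_Integration.integrable_bound)
    have "(norm (f x - g x))\<^sup>2 \<le> 2 * ((norm (f x))\<^sup>2 + (norm (g x))\<^sup>2)" for x
    proof -
      have "(norm (f x - g x))\<^sup>2 \<le> (norm (f x) + norm (g x))\<^sup>2"
        by (intro power_mono norm_triangle_ineq4) auto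
      also have "\<dots> \<le> 2 * ((norm (f x))\<^sup>2 + (norm (g x))\<^sup>2)"
        using zero_le_power2[of "norm (f x) - norm (g x)"]
        by (simp add: power2_eq_square algebra_simps)
      finally show ?thesis .
    qed
    thus "AE x in M. norm ((norm (f x - g x))\<^sup>2) \<le> norm (2 * ((norm (f x))\<^sup>2 + (norm (g x))\<^sup>2))"
      by simp
  qed measurable
  thus ?thesis by (simp add: L2_space_def)
qed

lemma L2_space_cmult: "f \<in> L2_space M \<Longrightarrow> (\<lambda>x. c * f x) \<in> L2_space M"
  by (auto simp: L2_space_def norm_mult power_mult_distrib)

lemma L2_space_zero: "(\<lambda>x. 0) \<in> L2_space M"
  by (simp add: L2_space_def)

lemma L2_space_add:
  assumes "f \<in> L2_space M" "g \<in> L2_space M"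
  shows "(\<lambda>x. f x + g x) \<in> L2_space M"
  using L2_space_diff[OF assms(1) L2_space_cmult[OF assms(2), of "-1"]] by simp

lemma L2_space_sum:
  assumes "\<And>i. i \<in> I \<Longrightarrow> f i \<in> L2_space M"
  shows "(\<lambda>x. \<Sum>i\<in>I. f i x) \<in> L2_space M"
  using assms by (induction I rule: infinite_finite_induct) (auto intro: L2_space_add L2_space_zero)

text \<open>The operator taking \<open>h\<close> to \<open>h (- t) - s * h t\<close> kills every
  finite combination of the \<open>e n\<close>. It is bounded, because reflection preserves the norm
  for the symmetric measure \<open>M\<close>; hence it also kills limits of such
  combinations.\<close>

lemma AE_parity_closed_span:
  fixes M :: "real measure" and e :: "nat \<Rightarrow> real \<Rightarrow> complex"
  assumes sets: "sets M = sets borel" and sym: "distr M borel uminus = M"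
    and e: "\<And>n. e n \<in> L2_space M" and parity: "\<And>n t. e n (- t) = s * e n t" and s: "norm s = 1"
    and f: "f \<in> L2_closed_span M e"
  shows "AE t in M. f (- t) = s * f t"
proof -
  have [measurable_cong]: "sets M = sets borel" by fact
  have fL2: "f \<in> L2_space M" using f by (simp add: L2_closed_span_def)
  have reflect: "(\<lambda>t. h (- t)) \<in> L2_space M"
    "(LINT t|M. (norm (h (- t)))\<^sup>2) = (LINT t|M. (norm (h t))\<^sup>2)" if "h \<in> L2_space M" for h
  proof -
    have h [measurable]: "h \<in> borel_measurable borel"
      using that measurable_cong_sets[OF sets refl] by (auto simp: L2_space_def)
    have "integrable (distr M borel uminus) (\<lambda>t. (norm (h t))\<^sup>2)"
      using that by (simp add: L2_space_def sym)
    hence "integrable M (\<lambda>t. (norm (h (- t)))\<^sup>2)"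
      by (subst (asm) integrable_distr_eq) auto
    thus "(\<lambda>t. h (- t)) \<in> L2_space M" by (simp add: L2_space_def)
    have "(LINT t|M. (norm (h t))\<^sup>2) = (LINT t|distr M borel uminus. (norm (h t))\<^sup>2)"
      by (simp add: sym)
    also have "\<dots> = (LINT t|M. (norm (h (- t)))\<^sup>2)"
      by (subst integral_distr) auto
    finally show "(LINT t|M. (norm (h (- t)))\<^sup>2) = (LINT t|M. (norm (h t))\<^sup>2)" ..
  qed
  let ?D = "\<lambda>t. f (- t) - s * f t"
  have D: "?D \<in> L2_space M"
    by (intro L2_space_diff L2_space_cmult fL2 reflect)
  have bound: "(LINT t|M. (norm (?D t))\<^sup>2) < 4 * \<epsilon>\<^sup>2" if "\<epsilon> > 0" for \<epsilon>
  proof -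
    obtain N c where Nc: "L2_norm M (\<lambda>x. f x - (\<Sum>n<N. c n * e n x)) < \<epsilon>"
      using f \<open>\<epsilon> > 0\<close> by (auto simp: L2_closed_span_def)
    define h where "h x = f x - (\<Sum>n<N. c n * e n x)" for x
    have h: "h \<in> L2_space M"
      unfolding h_def [abs_def] by (intro L2_space_diff L2_space_sum L2_space_cmult fL2 e)
    have le: "(norm (?D t))\<^sup>2 \<le> 2 * ((norm (h (- t)))\<^sup>2 + (norm (h t))\<^sup>2)" for t
    proof -
      \<comment> \<open>By \<open>parity\<close> the finite sum drops out, leaving only the small
        remainder \<open>h\<close>.\<close>
      have "?D t = h (- t) - s * h t" by (simp add: h_def parity sum_distrib_left algebra_simps)
      hence "norm (?D t) \<le> norm (h (- t)) + norm (h t)"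
        using norm_triangle_ineq4[of "h (- t)" "s * h t"] s by (simp add: norm_mult)
      hence "(norm (?D t))\<^sup>2 \<le> (norm (h (- t)) + norm (h t))\<^sup>2" by (intro power_mono) auto
      also have "\<dots> \<le> 2 * ((norm (h (- t)))\<^sup>2 + (norm (h t))\<^sup>2)"
        using zero_le_power2[of "norm (h (- t)) - norm (h t)"]
        by (simp add: power2_eq_square algebra_simps)
      finally show ?thesis .
    qed
    have i: "integrable M (\<lambda>t. (norm (h t))\<^sup>2)" "integrable M (\<lambda>t. (norm (h (- t)))\<^sup>2)"
      using h reflect(1)[OF h] by (simp_all add: L2_space_def)
    have "(LINT t|M. (norm (?D t))\<^sup>2) \<le> (LINT t|M. 2 * ((norm (h (- t)))\<^sup>2 + (norm (h t))\<^sup>2))"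
      using D i le by (intro integral_mono) (auto simp: L2_space_def)
    also have "\<dots> = 4 * (LINT t|M. (norm (h t))\<^sup>2)"
      using i reflect(2)[OF h] by simp
    also have "\<dots> = 4 * (L2_norm M h)\<^sup>2" by (simp add: power2_L2_norm)
    also have "\<dots> < 4 * \<epsilon>\<^sup>2"
      using Nc unfolding h_def [abs_def, symmetric]
      by (intro mult_strict_left_mono power_strict_mono) (auto simp: L2_norm_def)
    finally show ?thesis .
  qed
  let ?I = "LINT t|M. (norm (?D t))\<^sup>2"
  have "?I = 0"
  proof (rule ccontr)
    assume "?I \<noteq> 0"
    moreover have "?I \<ge> 0" by simp
    ultimately have "?I > 0" by linarith
    \<comment> \<open>For this choice the bound reads \<open>?I < ?I\<close>.\<close>
    with bound[of "sqrt ?I / 2"] show False by (simp add: power_divide)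
  qed
  hence "AE t in M. (norm (?D t))\<^sup>2 = 0"
    using D by (subst (asm) integral_nonneg_eq_0_iff_AE) (auto simp: L2_space_def)
  thus ?thesis by eventually_elim simp
qed

text \<open>Induction on \<open>K\<close>: subtracting a multiple of \<open>P K\<close> removes the
  coefficient of degree \<open>K\<close>. The case \<open>p = 0\<close> is listed because for
  \<open>K = 0\<close> it is the only one left.\<close>

lemma poly_expansion:
  fixes P :: "nat \<Rightarrow> 'a::field poly"
  assumes deg: "\<And>n. degree (P n) = n" and nz: "\<And>n. P n \<noteq> 0" and p: "p = 0 \<or> degree p < K"
  obtains a where "p = (\<Sum>n<K. smult (a n) (P n))"
proof -
  have "\<exists>a. p = (\<Sum>n<K. smult (a n) (P n))" using p
  proof (induction K arbitrary: p)
    case (Suc K)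
    define c where "c = coeff p K / coeff (P K) K"
    have PK: "coeff (P K) K \<noteq> 0" using deg[of K] nz[of K] by (metis leading_coeff_0_iff)
    let ?r = "p - smult c (P K)"
    have "degree ?r \<le> K"
      using Suc.prems deg[of K]
      by (intro degree_diff_le) (auto intro: order.trans[OF degree_smult_le])
    moreover have "coeff ?r K = 0" using PK by (simp add: c_def)
    ultimately have "?r = 0 \<or> degree ?r < K" using eq_zero_or_degree_less by blast
    then obtain a where a: "?r = (\<Sum>n<K. smult (a n) (P n))" using Suc.IH by blast
    have "p = ?r + smult c (P K)" by simp
    also have "\<dots> = (\<Sum>n<Suc K. smult ((a(K := c)) n) (P n))" unfolding a by simp
    finally show ?case by blast
  qed simp
  thus ?thesis using that by blast
qed

context
  fixes M N :: "real measure" and v :: "real \<Rightarrow> real"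
  assumes M [measurable_cong]: "sets M = sets borel"
    and v [measurable]: "v \<in> borel_measurable borel"
    and N: "distr (density M (\<lambda>t. ennreal ((v t)\<^sup>2))) borel tanh_var = N"
begin

text \<open>This is the isometry behind the transfer: integrals of products of functions
  \<open>v(t) p(tanh_var t)\<close> over \<open>M\<close> become integrals of products of the
  \<open>p\<close> over \<open>N\<close>.\<close>

lemma transfer_tanh_var:
  fixes F :: "real \<Rightarrow> 'b::{banach, second_countable_topology}"
  assumes [measurable]: "F \<in> borel_measurable borel"
  shows "integrable M (\<lambda>t. (v t)\<^sup>2 *\<^sub>R F (tanh_var t)) \<longleftrightarrow> integrable N F"
    and "(LINT t|M. (v t)\<^sup>2 *\<^sub>R F (tanh_var t)) = (LINT x|N. F x)"
  unfolding N[symmetric]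
  by (simp_all add: integrable_distr_eq integrable_density integral_distr integral_density)

end

text \<open>The sign \<open>s\<close> lets one argument serve even and odd functions. Norms and
  orthogonality are read off on \<open>N\<close>; for completeness, a function of parity
  \<open>s\<close> divided by \<open>v\<close> is even, hence a function of
  \<open>tanh_var t\<close>, and that function is approximated by polynomials.\<close>

lemma L2_orthogonal_basis_tanh_var:
  fixes M N :: "real measure" and v :: "real \<Rightarrow> real" and P :: "nat \<Rightarrow> real poly" and s :: real
  assumes M: "sets M = sets borel" "distr M borel uminus = M" "AE t in M. t \<noteq> 0"
    and v: "v \<in> borel_measurable borel" "\<And>t. t \<noteq> 0 \<Longrightarrow> v t \<noteq> 0" "\<And>t. v (- t) = s * v t"
    and s: "\<bar>s\<bar> = 1"
    and N: "distr (density M (\<lambda>t. ennreal ((v t)\<^sup>2))) borel tanh_var = N"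
      "finite_measure N" "absolutely_continuous lborel N" "AE x in N. x \<in> {-1..1}"
    and P: "\<And>n. degree (P n) = n" "\<And>n. (LINT x|N. (poly (P n) x)\<^sup>2) \<noteq> 0"
      "\<And>m n. m \<noteq> n \<Longrightarrow> (LINT x|N. poly (P m) x * poly (P n) x) = 0"
    and e: "\<And>n t. e n t = complex_of_real (v t * poly (P n) (tanh_var t))"
  shows "L2_orthogonal_basis M {f \<in> L2_space M. AE t in M. f (- t) = of_real s * f t} e"
    and "(L2_norm M (e n))\<^sup>2 = (LINT x|N. (poly (P n) x)\<^sup>2)"
proof -
  interpret N: finite_measure N by fact
  have setsN [measurable_cong]: "sets N = sets borel" using N(1) by auto
  note [measurable_cong] = M(1)
  note [measurable] = v(1)
  have [measurable]: "poly p \<in> borel_measurable borel" for p :: "real poly"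
    by (intro borel_measurable_continuous_onI continuous_intros)
  note transfer = transfer_tanh_var[OF M(1) v(1) N(1)]
  have poly_int: "integrable N (poly p)" for p
  proof -
    have "bounded (poly p ` {-1..1})"
      by (intro compact_imp_bounded compact_continuous_image continuous_intros) auto
    then obtain B where "\<forall>y\<in>poly p ` {-1..1}. norm y \<le> B" unfolding bounded_iff ..
    hence B: "norm (poly p x) \<le> B" if "x \<in> {-1..1}" for x using that by blast
    have "AE x in N. norm (poly p x) \<le> B" using N(4) by eventually_elim (rule B)
    thus ?thesis by (rule N.integrable_const_bound) measurable
  qed
  have norm_e: "(norm (e n t))\<^sup>2 = (v t)\<^sup>2 *\<^sub>R (poly (P n) (tanh_var t))\<^sup>2" for n t
    by (simp add: e norm_mult power_mult_distrib)
  have [measurable]: "e n \<in> borel_measurable borel" for n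
    unfolding e [abs_def] by measurable
  have eL2: "e n \<in> L2_space M" for n
  proof -
    have "integrable N (\<lambda>x. (poly (P n) x)\<^sup>2)" using poly_int[of "P n * P n"]
      by (simp add: power2_eq_square flip: poly_mult)
    hence "integrable M (\<lambda>t. (norm (e n t))\<^sup>2)" unfolding norm_e by (subst transfer) auto
    thus ?thesis by (simp add: L2_space_def)
  qed
  show L2e: "(L2_norm M (e n))\<^sup>2 = (LINT x|N. (poly (P n) x)\<^sup>2)" for n
    unfolding power2_L2_norm norm_e by (rule transfer) auto
  have orth: "L2_inner M (e m) (e n) = 0" if "m \<noteq> n" for m n
  proof -
    have "e m t * cnj (e n t) =
        complex_of_real ((v t)\<^sup>2 *\<^sub>R (poly (P m) (tanh_var t) * poly (P n) (tanh_var t)))" for t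
      by (simp add: e power2_eq_square)
    hence "L2_inner M (e m) (e n) = complex_of_real
        (LINT t|M. (v t)\<^sup>2 *\<^sub>R (poly (P m) (tanh_var t) * poly (P n) (tanh_var t)))"
      unfolding L2_inner_def by (simp only: integral_complex_of_real)
    also have "(LINT t|M. (v t)\<^sup>2 *\<^sub>R (poly (P m) (tanh_var t) * poly (P n) (tanh_var t))) =
        (LINT x|N. poly (P m) x * poly (P n) x)"
      by (rule transfer) auto
    finally show ?thesis using P(3)[OF that] by simp
  qed
  have parity: "e n (- t) = of_real s * e n t" for n t by (simp add: e v(3))
  have P0: "P n \<noteq> 0" for n using P(2)[of n] by auto
  have "f \<in> L2_closed_span M e"
    if f: "f \<in> L2_space M" "AE t in M. f (- t) = of_real s * f t" for f
  proof -
    have [measurable]: "f \<in> borel_measurable borel"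
      using f(1) measurable_cong_sets[OF M(1) refl] by (auto simp: L2_space_def)
    \<comment> \<open>The quotient of \<open>f\<close> by \<open>v\<close>, evaluated at the
      positive preimage of \<open>x\<close>.\<close>
    define G where "G x = f (tanh_var_inv x) / of_real (v (tanh_var_inv x))" for x
    have [measurable]: "G \<in> borel_measurable borel" unfolding G_def [abs_def] by measurable
    have fG: "AE t in M. f t = of_real (v t) * G (tanh_var t)"
      using f(2) M(3)
    proof eventually_elim
      case (elim t)
      show ?case
      proof (cases "t > 0")
        case True
        thus ?thesis using v(2)[of t] by (simp add: G_def tanh_var_inv_tanh_var)
      next
        case False
        \<comment> \<open>For negative \<open>t\<close> the value of \<open>G\<close> is computed at
          \<open>- t\<close>; there \<open>f\<close> and \<open>v\<close> both acquire the sign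
          \<open>s\<close>, which cancels in the quotient.\<close>
        hence "tanh_var_inv (tanh_var t) = - t"
          using elim tanh_var_inv_tanh_var[of "- t"] by simp
        thus ?thesis using elim v(2)[of t] s by (simp add: G_def v(3))
      qed
    qed
    have "integrable M (\<lambda>t. (norm (f t))\<^sup>2)" using f(1) by (simp add: L2_space_def)
    also have "?this \<longleftrightarrow> integrable M (\<lambda>t. (v t)\<^sup>2 *\<^sub>R (norm (G (tanh_var t)))\<^sup>2)"
      by (intro integrable_cong_AE)
        (use fG in \<open>auto elim!: eventually_mono simp: norm_mult power_mult_distrib\<close>)
    also have "\<dots> \<longleftrightarrow> integrable N (\<lambda>x. (norm (G x))\<^sup>2)" by (rule transfer) auto
    finally have G2: "integrable N (\<lambda>x. (norm (G x))\<^sup>2)" .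
    \<comment> \<open>The density result is for real functions, so real and imaginary parts are
      approximated separately, each with squared error below half of the square of
      \<open>\<epsilon>\<close>.\<close>
    have ReIm: "integrable N (\<lambda>x. (Re (G x))\<^sup>2)" "integrable N (\<lambda>x. (Im (G x))\<^sup>2)"
      by (rule Bochner_Integration.integrable_bound[OF G2]; auto simp: cmod_power2)+
    have "\<exists>K c. L2_norm M (\<lambda>x. f x - (\<Sum>n<K. c n * e n x)) < \<epsilon>" if "\<epsilon> > 0" for \<epsilon>
    proof -
      note dense = polynomials_dense_L2_real[OF N(2) setsN N(3,4)]
      obtain p where p: "integrable N (\<lambda>x. (Re (G x) - poly p x)\<^sup>2)"
          "(LINT x|N. (Re (G x) - poly p x)\<^sup>2) < \<epsilon>\<^sup>2 / 2"
        using dense[of "\<lambda>x. Re (G x)" "\<epsilon>\<^sup>2 / 2"] ReIm \<open>\<epsilon> > 0\<close> by auto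
      obtain q where q: "integrable N (\<lambda>x. (Im (G x) - poly q x)\<^sup>2)"
          "(LINT x|N. (Im (G x) - poly q x)\<^sup>2) < \<epsilon>\<^sup>2 / 2"
        using dense[of "\<lambda>x. Im (G x)" "\<epsilon>\<^sup>2 / 2"] ReIm \<open>\<epsilon> > 0\<close> by auto
      \<comment> \<open>A common length for both expansions, so that their real coefficients combine
        into complex ones.\<close>
      define K where "K = Suc (max (degree p) (degree q))"
      have K: "p = 0 \<or> degree p < K" "q = 0 \<or> degree q < K" by (auto simp: K_def)
      obtain a where a: "p = (\<Sum>n<K. smult (a n) (P n))"
        by (rule poly_expansion[OF P(1) P0 K(1)])
      obtain c where c: "q = (\<Sum>n<K. smult (c n) (P n))"
        by (rule poly_expansion[OF P(1) P0 K(2)])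
      have sum: "(\<Sum>n<K. Complex (a n) (c n) * e n t) =
          of_real (v t) * Complex (poly p (tanh_var t)) (poly q (tanh_var t))" for t
        unfolding a c by (rule complex_eqI) (simp_all add: e poly_sum sum_distrib_left mult_ac)
      have "(LINT t|M. (norm (f t - (\<Sum>n<K. Complex (a n) (c n) * e n t)))\<^sup>2) =
          (LINT t|M. (v t)\<^sup>2 *\<^sub>R ((Re (G (tanh_var t)) - poly p (tanh_var t))\<^sup>2 +
            (Im (G (tanh_var t)) - poly q (tanh_var t))\<^sup>2))"
      proof (rule integral_cong_AE)
        show "AE t in M. (norm (f t - (\<Sum>n<K. Complex (a n) (c n) * e n t)))\<^sup>2 =
          (v t)\<^sup>2 *\<^sub>R ((Re (G (tanh_var t)) - poly p (tanh_var t))\<^sup>2 +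
            (Im (G (tanh_var t)) - poly q (tanh_var t))\<^sup>2)"
          using fG
        proof eventually_elim
          case (elim t)
          have "f t - (\<Sum>n<K. Complex (a n) (c n) * e n t) = of_real (v t) *
              (G (tanh_var t) - Complex (poly p (tanh_var t)) (poly q (tanh_var t)))"
            unfolding sum elim by (simp add: algebra_simps)
          thus ?case by (simp add: norm_mult power_mult_distrib cmod_power2)
        qed
      qed auto
      also have "\<dots> = (LINT x|N. (Re (G x) - poly p x)\<^sup>2 + (Im (G x) - poly q x)\<^sup>2)"
        by (rule transfer) auto
      also have "\<dots> < \<epsilon>\<^sup>2" using p q by simp
      finally have "L2_norm M (\<lambda>t. f t - (\<Sum>n<K. Complex (a n) (c n) * e n t)) < sqrt (\<epsilon>\<^sup>2)"
        unfolding L2_norm_def by (rule real_sqrt_less_mono)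
      thus ?thesis using \<open>\<epsilon> > 0\<close> by auto
    qed
    thus ?thesis using f(1) by (simp add: L2_closed_span_def)
  qed
  \<comment> \<open>The converse inclusion: parity survives passage to the closed span.\<close>
  moreover have "f \<in> L2_space M \<and> (AE t in M. f (- t) = of_real s * f t)"
    if "f \<in> L2_closed_span M e" for f
    using AE_parity_closed_span[OF M(1,2) eL2 parity _ that] that s
    by (simp add: L2_closed_span_def)
  ultimately have "L2_closed_span M e = {f \<in> L2_space M. AE t in M. f (- t) = of_real s * f t}"
    by blast
  moreover have "L2_norm M (e n) \<noteq> 0" for n using L2e[of n] P(2)[of n] by auto
  ultimately show "L2_orthogonal_basis M {f \<in> L2_space M. AE t in M. f (- t) = of_real s * f t} e"
    using eL2 orth by (auto simp: L2_orthogonal_basis_def)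
qed

section \<open>The measure \<open>\<mu>\<close>\<close>

lemma sets_mu [measurable_cong]: "sets (\<mu> b \<iota>) = sets borel"
  by (simp add: \<mu>_def)

text \<open>Lebesgue measure is invariant under reflection, and the density sees \<open>sinh\<close>
  only through absolute values.\<close>

lemma distr_mu_uminus: "distr (\<mu> b \<iota>) borel uminus = \<mu> b \<iota>"
proof -
  let ?d = "\<lambda>t. ennreal (2 powr (2 * b + \<iota>) * \<bar>sinh t\<bar> powr (2 * b) * \<bar>sinh (2 * t)\<bar> powr \<iota>)"
  have "density (distr lborel borel uminus) ?d = distr (density lborel (\<lambda>t. ?d (- t))) borel uminus"
    by (rule density_distr) auto
  thus ?thesis by (simp add: \<mu>_def lborel_distr_uminus)
qed

text \<open>Both families in one statement: the exponent \<open>j\<close> of \<open>tanh t\<close>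
  determines the parity \<open>(-1)^j\<close> and shifts the second Jacobi parameter by
  \<open>j\<close>.\<close>

lemma jacobi_tanh_basis:
  fixes b \<iota> \<sigma> :: real and j :: nat
  assumes b: "b > 0" and i: "\<iota> > 0" and \<sigma>: "\<sigma> > \<iota> + b"
  defines "\<alpha> \<equiv> \<sigma> - (\<iota> + b + 1)" and "\<beta> \<equiv> (\<iota> - 1) / 2 + b + real j"
  defines "S \<equiv> \<alpha> + \<beta> + 1"
  assumes Q: "\<And>n t. Q n t = complex_of_real
    (cosh t powr (- \<sigma>) * tanh t ^ j * poly (jacobi_poly \<alpha> \<beta> n) (2 * (tanh t)\<^sup>2 - 1))"
  shows "L2_orthogonal_basis (\<mu> b \<iota>)
      {f \<in> L2_space (\<mu> b \<iota>). AE t in \<mu> b \<iota>. f (- t) = of_real ((-1) ^ j) * f t} Q"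
    and "(L2_norm (\<mu> b \<iota>) (Q n))\<^sup>2 = 2 powr (2 * (\<iota> + b)) *
      (Gamma (real n + \<alpha> + 1) * Gamma (real n + \<beta> + 1) /
      (fact n * (if n = 0 \<and> S = 0 then 1 else (2 * real n + S) * Gamma (real n + S))))"
proof -
  have ab: "\<alpha> > -1" "\<beta> > -1"
    using b i \<sigma> by (auto simp: \<alpha>_def \<beta>_def field_simps add_pos_nonneg)
  \<comment> \<open>The constant produced by \<open>weight_tanh_var\<close>, written with
    \<open>S = \<alpha> + \<beta> + 1\<close>.\<close>
  define K where "K = 2 powr (2 * (\<iota> + b) - S - 1)"
  have K: "K > 0" by (simp add: K_def)
  define g where "g x = K * ((1 - x) powr \<alpha> * (1 + x) powr \<beta>)" for x
  define v where "v t = cosh t powr (- \<sigma>) * tanh t ^ j" for t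
  define d where "d t = 2 powr (2 * b + \<iota>) * \<bar>sinh t\<bar> powr (2 * b) * \<bar>sinh (2 * t)\<bar> powr \<iota>" for t
  define N where "N = density lborel (\<lambda>x. ennreal (2 * (indicator {-1<..<1} x * g x)))"
  let ?J = "jacobi_hyp \<alpha> \<beta>"
  have J: "jacobi_poly \<alpha> \<beta> n = ?J n" for n by (rule jacobi_poly_eq_jacobi_hyp[OF ab])
  have [measurable]: "v \<in> borel_measurable borel" "g \<in> borel_measurable borel"
      "d \<in> borel_measurable borel"
    unfolding v_def [abs_def] g_def [abs_def] d_def [abs_def] by measurable
  have [measurable]: "poly p \<in> borel_measurable borel" for p :: "real poly"
    by (intro borel_measurable_continuous_onI continuous_intros)
  have g0: "g x \<ge> 0" for x using K by (simp add: g_def)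
  have vm: "v (- t) = (-1) ^ j * v t" for t by (simp add: v_def power_minus')
  have mu: "\<mu> b \<iota> = density lborel (\<lambda>t. ennreal (d t))" by (simp add: \<mu>_def d_def [abs_def])
  have d0: "d t \<ge> 0" for t by (simp add: d_def)
  have "density (\<mu> b \<iota>) (\<lambda>t. ennreal ((v t)\<^sup>2)) = density lborel (\<lambda>t. ennreal (d t * (v t)\<^sup>2))"
    unfolding mu by (subst density_density_eq) (auto simp: ennreal_mult d0)
  also have "distr \<dots> borel tanh_var = N"
    unfolding N_def
  proof (rule distr_tanh_var_density)
    fix t :: real
    show "d (- t) * (v (- t))\<^sup>2 = d t * (v t)\<^sup>2" by (cases "even j") (simp_all add: d_def vm)
    assume "t > 0"
    from weight_tanh_var[OF this, of b \<iota> \<sigma> j]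
    show "d t * (v t)\<^sup>2 = g (tanh_var t) * (4 * tanh t * (1 - (tanh t)\<^sup>2))"
      unfolding d_def v_def g_def K_def S_def \<alpha>_def \<beta>_def .
  qed (auto intro: g0)
  finally have dist: "distr (density (\<mu> b \<iota>) (\<lambda>t. ennreal ((v t)\<^sup>2))) borel tanh_var = N" .
  have intN: "(LINT x|N. F x) =
      2 * K * (LBINT x:{-1<..<1}. (1 - x) powr \<alpha> * (1 + x) powr \<beta> * F x)"
    if [measurable]: "F \<in> borel_measurable borel" for F :: "real \<Rightarrow> real"
  proof -
    have "(LINT x|N. F x) = (LINT x|lborel. (2 * (indicator {-1<..<1} x * g x)) *\<^sub>R F x)"
      unfolding N_def by (rule integral_density) (auto intro!: AE_I2 mult_nonneg_nonneg g0)
    also have "\<dots> = (LINT x|lborel. 2 * K *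
        (indicator {-1<..<1} x *\<^sub>R ((1 - x) powr \<alpha> * (1 + x) powr \<beta> * F x)))"
      by (simp add: g_def mult_ac)
    finally show ?thesis by (simp add: set_lebesgue_integral_def)
  qed
  have fin: "finite_measure N"
  proof (rule finite_measureI)
    have "integrable lborel
        (\<lambda>x. 2 * K * (indicator {-1<..<1} x *\<^sub>R ((1 - x) powr \<alpha> * (1 + x) powr \<beta>)))"
      using jacobi_weight_moment[OF ab] by (auto simp: has_bochner_integral_iff)
    hence "integrable lborel (\<lambda>x. 2 * (indicator {-1<..<1} x * g x))"
      by (simp add: g_def mult_ac)
    hence "(\<integral>\<^sup>+x. ennreal (2 * (indicator {-1<..<1} x * g x)) \<partial>lborel) \<noteq> \<infinity>"
      by (subst nn_integral_eq_integral) (auto intro!: AE_I2 mult_nonneg_nonneg g0)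
    thus "emeasure N (space N) \<noteq> \<infinity>"
      by (simp add: N_def emeasure_density)
  qed
  have ac: "absolutely_continuous lborel N"
    unfolding N_def by (intro absolutely_continuousI_density) auto
  have bdd: "AE x in N. x \<in> {-1..1}"
    unfolding N_def by (subst AE_density) (auto simp: indicator_def)
  have normJ: "(LINT x|N. (poly (?J n) x)\<^sup>2) = 2 powr (2 * (\<iota> + b)) *
      (Gamma (real n + \<alpha> + 1) * Gamma (real n + \<beta> + 1) /
      (fact n * (if n = 0 \<and> S = 0 then 1 else (2 * real n + S) * Gamma (real n + S))))" for n
  proof -
    \<comment> \<open>The 2 counts the two half-lines and \<open>2 powr S\<close> comes from the
      Jacobi norm; together with \<open>K\<close> they leave the constant of the norm
      formula.\<close>
    have "2 * K * 2 powr S = 2 powr (2 * (\<iota> + b))"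
      by (simp add: K_def powr_diff)
    thus ?thesis
      using jacobi_hyp_norm[OF ab, of n] unfolding S_def[symmetric]
      by (subst intN) (auto simp: power2_eq_square mult.assoc[symmetric])
  qed
  have nzJ: "(LINT x|N. (poly (?J n) x)\<^sup>2) \<noteq> 0" for n
  proof
    assume "(LINT x|N. (poly (?J n) x)\<^sup>2) = 0"
    \<comment> \<open>A vanishing norm would force the zero polynomial, but the value at 1 is
      positive.\<close>
    hence "?J n = 0"
      using K by (intro jacobi_weight_definite[OF ab]) (simp add: intN power2_eq_square)
    hence "poly (?J n) 1 = 0" by simp
    moreover have "pochhammer (\<alpha> + 1) n > 0" using ab by (intro pochhammer_pos) auto
    ultimately show False by (simp add: poly_jacobi_hyp_1)
  qed
  \<comment> \<open>The defining orthogonality concerns polynomials of smaller degree only; symmetry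
    then covers all distinct indices.\<close>
  have less: "(LINT x|N. poly (?J n) x * poly (?J m) x) = 0" if "m < n" for m n
    using is_jacobi_poly_jacobi_hyp[OF ab, of n] that degree_jacobi_hyp[OF ab, of m]
    by (subst intN) (auto simp: is_jacobi_poly_def)
  have orth: "(LINT x|N. poly (?J m) x * poly (?J n) x) = 0" if "m \<noteq> n" for m n
    using less[of m n] less[of n m] that by (cases "m < n") (auto simp: mult.commute)
  have "AE t in lborel. t \<noteq> (0::real)" by (rule AE_lborel_singleton)
  hence nz: "AE t in \<mu> b \<iota>. t \<noteq> 0"
    unfolding mu by (subst AE_density) auto
  have vn: "v t \<noteq> 0" if "t \<noteq> 0" for t using that by (simp add: v_def)
  have Q': "Q n t = complex_of_real (v t * poly (?J n) (tanh_var t))" for n t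
    by (simp add: Q J v_def tanh_var_def)
  have s: "\<bar>(-1) ^ j :: real\<bar> = 1" by simp
  note basis = L2_orthogonal_basis_tanh_var[OF sets_mu distr_mu_uminus nz _ vn vm s dist fin ac bdd
      degree_jacobi_hyp[OF ab] nzJ orth Q']
  show "L2_orthogonal_basis (\<mu> b \<iota>)
      {f \<in> L2_space (\<mu> b \<iota>). AE t in \<mu> b \<iota>. f (- t) = of_real ((-1) ^ j) * f t} Q"
    by (rule basis(1)) measurable
  show "(L2_norm (\<mu> b \<iota>) (Q n))\<^sup>2 = 2 powr (2 * (\<iota> + b)) *
      (Gamma (real n + \<alpha> + 1) * Gamma (real n + \<beta> + 1) /
      (fact n * (if n = 0 \<and> S = 0 then 1 else (2 * real n + S) * Gamma (real n + S))))"
    unfolding normJ[symmetric] by (rule basis(2)) measurable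
qed

theorem lemma3p1:
  fixes b \<iota> \<sigma> :: real and k :: nat
  assumes "b > 0" and "\<iota> > 0" and "\<sigma> > \<iota> + b"
  shows "L2_orthogonal_basis (\<mu> b \<iota>) (L2_even (\<mu> b \<iota>)) (Q_even b \<iota> \<sigma> k)
    \<and> L2_orthogonal_basis (\<mu> b \<iota>) (L2_odd (\<mu> b \<iota>)) (Q_odd b \<iota> \<sigma> k)
    \<and> (\<forall>n. (L2_norm (\<mu> b \<iota>) (Q_even b \<iota> \<sigma> k n))\<^sup>2 =
          2 powr (2 * (\<iota> + b)) *
          (Gamma (real n + \<sigma> - \<iota> - b) * Gamma (real n + 2 * real k + (\<iota> + 2 * b + 1) / 2) /
            (fact n *
              (if n = 0 \<and> 2 * real k + \<sigma> - (\<iota> + 1) / 2 = 0 then 1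
               else (2 * real n + 2 * real k + \<sigma> - (\<iota> + 1) / 2) *
                 Gamma (real n + 2 * real k + \<sigma> - (\<iota> + 1) / 2)))))
    \<and> (\<forall>n. (L2_norm (\<mu> b \<iota>) (Q_odd b \<iota> \<sigma> k n))\<^sup>2 =
          2 powr (2 * (\<iota> + b)) *
          (Gamma (real n + \<sigma> - \<iota> - b) * Gamma (real n + 2 * real k + (\<iota> + 2 * b + 1) / 2 + 1) /
            (fact n * (2 * real n + 2 * real k + \<sigma> - (\<iota> - 1) / 2) *
              Gamma (real n + 2 * real k + \<sigma> - (\<iota> - 1) / 2))))"
proof -
  let ?\<alpha> = "\<sigma> - (\<iota> + b + 1)" and ?\<beta> = "\<lambda>j. (\<iota> - 1) / 2 + b + real j"
  have even: "Q_even b \<iota> \<sigma> k n t = complex_of_real (cosh t powr (- \<sigma>) * tanh t ^ (2 * k) *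
      poly (jacobi_poly ?\<alpha> (?\<beta> (2 * k)) n) (2 * (tanh t)\<^sup>2 - 1))" for n t
    by (simp add: Q_even_def w_def \<sigma>\<^sub>0_def \<delta>\<^sub>0_def)
  \<comment> \<open>The step from \<open>\<delta>\<^sub>0\<close> to \<open>\<delta>\<^sub>1\<close>
    matches the additional factor \<open>tanh t\<close>, so the odd family is the case
    \<open>j = 2 * k + 1\<close>.\<close>
  have \<beta>1: "\<delta>\<^sub>1 b \<iota> + 2 * real k = ?\<beta> (2 * k + 1)" by (simp add: \<delta>\<^sub>1_def \<delta>\<^sub>0_def)
  have odd: "Q_odd b \<iota> \<sigma> k n t = complex_of_real (cosh t powr (- \<sigma>) * tanh t ^ (2 * k + 1) *
      poly (jacobi_poly ?\<alpha> (?\<beta> (2 * k + 1)) n) (2 * (tanh t)\<^sup>2 - 1))" for n t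
    unfolding Q_odd_def w_def \<sigma>\<^sub>0_def \<beta>1 by (simp add: mult_ac)
  note E = jacobi_tanh_basis[where Q = "Q_even b \<iota> \<sigma> k" and j = "2 * k", OF assms even]
  note O = jacobi_tanh_basis[where Q = "Q_odd b \<iota> \<sigma> k" and j = "2 * k + 1", OF assms odd]
  have basis: "L2_orthogonal_basis (\<mu> b \<iota>) (L2_even (\<mu> b \<iota>)) (Q_even b \<iota> \<sigma> k)"
    "L2_orthogonal_basis (\<mu> b \<iota>) (L2_odd (\<mu> b \<iota>)) (Q_odd b \<iota> \<sigma> k)"
    using E(1) O(1) by (simp_all add: L2_even_def L2_odd_def)
  have \<alpha>n: "real n + ?\<alpha> + 1 = real n + \<sigma> - \<iota> - b" for n by simp
  have \<beta>n: "real n + ?\<beta> (2 * k) + 1 = real n + 2 * real k + (\<iota> + 2 * b + 1) / 2"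
    "real n + ?\<beta> (2 * k + 1) + 1 = real n + 2 * real k + (\<iota> + 2 * b + 1) / 2 + 1" for n
    by (simp_all add: field_simps)
  have S: "?\<alpha> + ?\<beta> (2 * k) + 1 = 2 * real k + \<sigma> - (\<iota> + 1) / 2"
    "?\<alpha> + ?\<beta> (2 * k + 1) + 1 = 2 * real k + \<sigma> - (\<iota> - 1) / 2"
    by (simp_all add: field_simps)
  have assoc: "x + (2 * real k + \<sigma> - y) = x + 2 * real k + \<sigma> - y" for x y by simp
  \<comment> \<open>In the odd case \<open>\<sigma> > \<iota> + b\<close> makes \<open>S\<close>
    positive, so the exceptional branch of the norm formula never occurs.\<close>
  have pos: "2 * real k + \<sigma> - (\<iota> - 1) / 2 \<noteq> 0"
  proof -
    have "2 * real k + \<sigma> - (\<iota> - 1) / 2 > 0"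
      using assms of_nat_0_le_iff[of k] unfolding diff_divide_distrib by linarith
    thus ?thesis by linarith
  qed
  note evenN = E(2)[unfolded \<alpha>n \<beta>n S assoc]
  note oddN = O(2)[unfolded \<alpha>n \<beta>n S assoc]
  show ?thesis
    using basis evenN oddN pos by (simp add: mult.assoc)
qed

end
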